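(* Let $d,n\ge1$ be integers, let $(x_i)_{i=1}^n$ be independent random vectors drawn from the uniform distribution on the closed Euclidean ball $\mathbb{B}^d_{\sqrt{(d+2)/n}}$ in $\mathbb{R}^d$ centered at the origin with radius $\sqrt{(d+2)/n}$, and let $S=\sum_{i=1}^n x_ix_i^*$ be the associated frame operator. Then, for every $\varepsilon\ge0$, $$\mathbb{P}\left(\|S-I_d\|_{\mathrm{op}}\ge\varepsilon\right)\le 2d\exp\left(-\frac{n\varepsilon^2}{2d+2+\frac{2\varepsilon(d+1)}{3}}\right)$$ and $$\mathbb{P}\left(\|S-I_d\|_{\mathrm{F}}\ge\varepsilon\right)\le 2d\exp\left(-\frac{n\varepsilon^2}{2d^2+2d+\frac{2\varepsilon\sqrt d(d+1)}{3}}\right).$$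
   Context: $\|\cdot\|_{\mathrm{op}}$ is the operator norm (with respect to the Euclidean norm) and $\|\cdot\|_{\mathrm F}$ the Frobenius norm. $x^*$ denotes the transpose. *)

theory Defs
  imports "HOL-Probability.Probability"
begin

(* The matrix of the frame operator of (x i) over I: the sum of the products x i (x i)^T,
   each a d x 1 matrix times a 1 x d matrix.  The type constraints fix the inner dimension to 1;
   columnvector and rowvector leave it arbitrary, and ** sums over it. *)
definition frame_operator :: "nat set \<Rightarrow> (nat \<Rightarrow> real ^ 'd) \<Rightarrow> real ^ 'd ^ 'd" where
  "frame_operator I x =
    (\<Sum>i\<in>I. (columnvector (x i) :: real ^ 1 ^ 'd) ** (rowvector (x i) :: real ^ 'd ^ 1))"

definition op_norm :: "real ^ 'd ^ 'd \<Rightarrow> real" where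
  "op_norm A = onorm (\<lambda>v. A *v v)"

definition frobenius_norm :: "real ^ 'd ^ 'd \<Rightarrow> real" where
  "frobenius_norm A = sqrt (\<Sum>i\<in>UNIV. \<Sum>j\<in>UNIV. (A $ i $ j)\<^sup>2)"

end

theory Submission
  imports Defs
begin

text \<open>Write \<open>S - I\<close> as the sum of the independent matrices \<open>X\<^sub>i = x\<^sub>i x\<^sub>i\<^sup>* - I / n\<close>. By the Laplace
  transform method it suffices to bound the expected trace of \<open>exp (t (S - I))\<close> for \<open>t = \<plusminus>\<theta>\<close>. The
  Golden--Thompson inequality splits off one summand at a time. Since the ball is symmetric, the
  expectation of \<open>exp (t X\<^sub>i)\<close> is a scalar matrix, so no loss occurs at this step and the expected
  trace is at most \<open>d\<close> times the \<open>n\<close>-th power of that scalar, which the usual Bernstein estimate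
  controls. The Frobenius bound is the operator norm bound at \<open>\<epsilon> / sqrt d\<close>.

  Golden--Thompson itself follows from the Lie--Trotter formula and
  \<open>tr ((A B)\<^sup>p) \<le> tr (A\<^sup>p B\<^sup>p)\<close> for self-adjoint \<open>A\<close>, \<open>B\<close> and \<open>p\<close> a power of two, a consequence of
  iterated Cauchy--Schwarz for the Hilbert--Schmidt inner product.\<close>

section \<open>The Banach algebra of square matrices\<close>

text \<open>A copy of the matrix type: the norm of the vector type is the Frobenius norm, for which the
  identity does not have norm 1, whereas the general \<^const>\<open>exp\<close> needs a unital Banach algebra.\<close>

typedef (overloaded) 'd sqmat = "UNIV :: (real ^ 'd ^ 'd) set"
  morphisms mat_of sq_of ..

setup_lifting type_definition_sqmat

lemma onorm_mult_le:
  fixes A B :: "real ^ 'd ^ 'd"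
  shows "onorm ((*v) (A ** B)) \<le> onorm ((*v) A) * onorm ((*v) B)"
proof -
  have "(*v) (A ** B) = (*v) A \<circ> (*v) B"
    by (auto simp: fun_eq_iff matrix_vector_mul_assoc)
  then show ?thesis
    using onorm_compose[OF matrix_vector_mul_bounded_linear matrix_vector_mul_bounded_linear] by metis
qed

lemma onorm_matrix_add_le:
  fixes A B :: "real ^ 'd ^ 'd"
  shows "onorm ((*v) (A + B)) \<le> onorm ((*v) A) + onorm ((*v) B)"
proof -
  have "(*v) (A + B) = (\<lambda>v. A *v v + B *v v)"
    by (simp add: fun_eq_iff matrix_vector_mult_add_rdistrib)
  then show ?thesis
    using onorm_triangle[OF matrix_vector_mul_bounded_linear matrix_vector_mul_bounded_linear, of A B] by simp
qed

lemma onorm_matrix_scaleR: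
  fixes A :: "real ^ 'd ^ 'd"
  shows "onorm ((*v) (r *\<^sub>R A)) = \<bar>r\<bar> * onorm ((*v) A)"
proof -
  have "(*v) (r *\<^sub>R A) = (\<lambda>v. r *\<^sub>R (A *v v))"
    by (simp add: fun_eq_iff scaleR_matrix_vector_assoc)
  then show ?thesis
    using onorm_scaleR[OF matrix_vector_mul_bounded_linear, of r A] by simp
qed

lemma onorm_mat_1: "onorm ((*v) (mat 1 :: real ^ 'd ^ 'd)) = 1"
proof -
  have "(*v) (mat 1 :: real ^ 'd ^ 'd) = (\<lambda>v. v)"
    by (simp add: fun_eq_iff)
  then show ?thesis
    by (simp add: onorm_id)
qed

instantiation sqmat :: (finite) real_normed_algebra_1
begin

lift_definition zero_sqmat :: "'a sqmat" is 0 .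
lift_definition one_sqmat :: "'a sqmat" is "mat 1" .
lift_definition plus_sqmat :: "'a sqmat \<Rightarrow> 'a sqmat \<Rightarrow> 'a sqmat" is "(+)" .
lift_definition minus_sqmat :: "'a sqmat \<Rightarrow> 'a sqmat \<Rightarrow> 'a sqmat" is "(-)" .
lift_definition uminus_sqmat :: "'a sqmat \<Rightarrow> 'a sqmat" is "uminus" .
lift_definition times_sqmat :: "'a sqmat \<Rightarrow> 'a sqmat \<Rightarrow> 'a sqmat" is "(**)" .
lift_definition scaleR_sqmat :: "real \<Rightarrow> 'a sqmat \<Rightarrow> 'a sqmat" is "scaleR" .
lift_definition norm_sqmat :: "'a sqmat \<Rightarrow> real" is "\<lambda>A. onorm ((*v) A)" .
definition dist_sqmat :: "'a sqmat \<Rightarrow> 'a sqmat \<Rightarrow> real" where "dist_sqmat A B = norm (A - B)"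
definition sgn_sqmat :: "'a sqmat \<Rightarrow> 'a sqmat" where "sgn_sqmat A = inverse (norm A) *\<^sub>R A"
definition
  "(uniformity :: ('a sqmat \<times> 'a sqmat) filter) = (INF e\<in>{0<..}. principal {(x, y). dist x y < e})"
definition open_sqmat :: "'a sqmat set \<Rightarrow> bool" where
  "open_sqmat S = (\<forall>x\<in>S. \<forall>\<^sub>F (x', y) in uniformity. x' = x \<longrightarrow> y \<in> S)"

instance
proof
  fix A B C :: "'a sqmat" and r s :: real
  show "A + B + C = A + (B + C)" "A + B = B + A" "0 + A = A" "- A + A = 0" "A - B = A + - B"
    by (transfer; simp add: algebra_simps)+
  show "r *\<^sub>R (A + B) = r *\<^sub>R A + r *\<^sub>R B" "(r + s) *\<^sub>R A = r *\<^sub>R A + s *\<^sub>R A"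
    "r *\<^sub>R s *\<^sub>R A = (r * s) *\<^sub>R A" "1 *\<^sub>R A = A"
    by (transfer; simp add: algebra_simps)+
  show "A * B * C = A * (B * C)"
    by transfer (simp add: matrix_mul_assoc)
  show "(A + B) * C = A * C + B * C"
    by transfer (simp add: matrix_matrix_mult_def vec_eq_iff algebra_simps sum.distrib)
  show "A * (B + C) = A * B + A * C"
    by transfer (rule matrix_add_ldistrib)
  show "r *\<^sub>R A * B = r *\<^sub>R (A * B)" "A * r *\<^sub>R B = r *\<^sub>R (A * B)"
    by (transfer; simp add: scalar_matrix_assoc matrix_scalar_ac)+
  show "1 * A = A" "A * 1 = A"
    by (transfer; simp)+
  show "(0 :: 'a sqmat) \<noteq> 1"
    by transfer (simp add: vec_eq_iff mat_def)
  show "dist A B = norm (A - B)"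
    by (fact dist_sqmat_def)
  show "sgn A = inverse (norm A) *\<^sub>R A"
    by (fact sgn_sqmat_def)
  show "(uniformity :: ('a sqmat \<times> 'a sqmat) filter) = (INF e\<in>{0<..}. principal {(x, y). dist x y < e})"
    by (fact uniformity_sqmat_def)
  show "open U = (\<forall>x\<in>U. \<forall>\<^sub>F (x', y) in uniformity. x' = x \<longrightarrow> y \<in> U)" for U :: "'a sqmat set"
    by (fact open_sqmat_def)
  show "norm A = 0 \<longleftrightarrow> A = 0"
    by transfer (simp add: onorm_eq_0 matrix_vector_mul_bounded_linear matrix_eq)
  show "norm (A + B) \<le> norm A + norm B"
    by transfer (rule onorm_matrix_add_le)
  show "norm (r *\<^sub>R A) = \<bar>r\<bar> * norm A"
    by transfer (rule onorm_matrix_scaleR)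
  show "norm (A * B) \<le> norm A * norm B"
    by transfer (rule onorm_mult_le)
  show "norm (1 :: 'a sqmat) = 1"
    by transfer (rule onorm_mat_1)
qed

end

section \<open>Transfer to and from the matrix type, and completeness\<close>

lemma bounded_linear_sq_of: "bounded_linear sq_of"
  by (rule linear_conv_bounded_linear[THEN iffD1])
    (auto intro!: linearI simp: plus_sqmat.abs_eq scaleR_sqmat.abs_eq eq_onp_same_args)

lemma mat_of_component_le: "\<bar>mat_of A $ i $ j\<bar> \<le> norm A"
  by transfer (rule matrix_component_le_onorm)

lemma bounded_linear_mat_of_component: "bounded_linear (\<lambda>A. mat_of A $ i $ j)"
  by (rule bounded_linear_intro[where K = 1])
    (auto simp: plus_sqmat.rep_eq scaleR_sqmat.rep_eq mat_of_component_le)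

text \<open>Each entry is at most the operator norm in absolute value, and there are d^2 entries;
  this gives the explicit constant.\<close>

lemma bounded_linear_mat_of: "bounded_linear (mat_of :: 'd::finite sqmat \<Rightarrow> _)"
proof (rule bounded_linear_intro)
  fix A :: "'d sqmat"
  have "norm (mat_of A) \<le> (\<Sum>i\<in>UNIV. norm (mat_of A $ i))"
    by (simp add: norm_vec_def L2_set_le_sum)
  also have "\<dots> \<le> (\<Sum>i\<in>UNIV. \<Sum>j\<in>UNIV. \<bar>mat_of A $ i $ j\<bar>)"
    by (intro sum_mono norm_le_l1_cart)
  also have "\<dots> \<le> (\<Sum>i\<in>(UNIV :: 'd set). \<Sum>j\<in>(UNIV :: 'd set). norm A)"
    by (intro sum_mono mat_of_component_le)
  finally show "norm (mat_of A) \<le> norm A * (real CARD('d) * real CARD('d))"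
    by (simp add: mult_ac)
qed (simp_all add: plus_sqmat.rep_eq scaleR_sqmat.rep_eq)

text \<open>Entries are bounded linear functionals, so a Cauchy sequence converges entrywise;
  boundedness of \<open>sq_of\<close> turns this into convergence in operator norm.\<close>

instance sqmat :: (finite) banach
proof
  fix X :: "nat \<Rightarrow> 'a sqmat"
  assume X: "Cauchy X"
  have "Cauchy (\<lambda>n. mat_of (X n) $ i $ j)" for i j
    by (rule bounded_linear.Cauchy[OF bounded_linear_mat_of_component X])
  then have "\<exists>L. (\<lambda>n. mat_of (X n) $ i $ j) \<longlonglongrightarrow> L" for i j
    by (simp add: Cauchy_convergent_iff convergent_def)
  then obtain L where L: "\<And>i j. (\<lambda>n. mat_of (X n) $ i $ j) \<longlonglongrightarrow> L i j"
    by metis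
  have "(\<lambda>n. mat_of (X n)) \<longlonglongrightarrow> (\<chi> i j. L i j)"
    by (intro vec_tendstoI) (simp add: L)
  then have "(\<lambda>n. sq_of (mat_of (X n))) \<longlonglongrightarrow> sq_of (\<chi> i j. L i j)"
    by (rule bounded_linear.tendsto[OF bounded_linear_sq_of])
  then show "convergent X"
    by (auto simp: mat_of_inverse convergent_def)
qed

section \<open>Transpose, trace and action on vectors\<close>

lift_definition adj :: "'d::finite sqmat \<Rightarrow> 'd sqmat" is transpose .
lift_definition tr :: "'d::finite sqmat \<Rightarrow> real" is trace .
lift_definition app :: "'d::finite sqmat \<Rightarrow> real ^ 'd \<Rightarrow> real ^ 'd" is "(*v)" .

lemma adj_adj [simp]: "adj (adj A) = A"
  by transfer simp

lemma adj_mult: "adj (A * B) = adj B * adj A"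
  by transfer (rule matrix_transpose_mul)

lemma adj_one [simp]: "adj 1 = 1"
  by transfer simp

lemma adj_power: "adj (A ^ n) = adj A ^ n"
  by (induction n) (simp_all add: adj_mult power_commutes)

lemma bounded_linear_adj: "bounded_linear (adj :: 'd::finite sqmat \<Rightarrow> _)"
proof -
  have adj: "adj = (\<lambda>A :: 'd sqmat. sq_of (transpose (mat_of A)))"
    by (simp add: fun_eq_iff adj.abs_eq mat_of_inverse flip: adj.rep_eq)
  have "bounded_linear (transpose :: real ^ 'd ^ 'd \<Rightarrow> _)"
    by (rule linear_conv_bounded_linear[THEN iffD1])
      (auto intro!: linearI simp: transpose_def vec_eq_iff)
  then show ?thesis
    unfolding adj
    by (intro bounded_linear_compose[OF bounded_linear_sq_of]
        bounded_linear_compose[OF _ bounded_linear_mat_of])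
qed

lemma adj_scaleR: "adj (c *\<^sub>R A) = c *\<^sub>R adj A"
  by (rule linear_scale[OF bounded_linear.linear[OF bounded_linear_adj]])

lemma tr_mult_commute: "tr (A * B) = tr (B * A)"
  by transfer (rule trace_mul_sym)

lemma tr_one [simp]: "tr (1 :: 'd::finite sqmat) = real CARD('d)"
  by transfer (rule trace_I)

lemma tr_mult_adj: "tr (A * adj A) = (\<Sum>i\<in>UNIV. \<Sum>j\<in>UNIV. (mat_of A $ i $ j)\<^sup>2)"
  by transfer (simp add: trace_def matrix_matrix_mult_def transpose_def power2_eq_square)

lemma tr_mult_adj_nonneg: "0 \<le> tr (A * adj A)"
  by (simp add: tr_mult_adj sum_nonneg)

lemma bounded_linear_tr: "bounded_linear (tr :: 'd::finite sqmat \<Rightarrow> real)"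
proof -
  have eq: "(tr :: 'd sqmat \<Rightarrow> real) = (\<lambda>A. \<Sum>i\<in>UNIV. mat_of A $ i $ i)"
    by (simp add: fun_eq_iff tr.rep_eq trace_def)
  show ?thesis
    unfolding eq by (intro bounded_linear_sum bounded_linear_mat_of_component)
qed

lemma tr_add: "tr (A + B) = tr A + tr B"
  by (rule linear_add[OF bounded_linear.linear[OF bounded_linear_tr]])

lemma tr_scaleR: "tr (c *\<^sub>R A) = c * tr A"
  using linear_scale[OF bounded_linear.linear[OF bounded_linear_tr]] by simp

text \<open>The trace of a product is the Euclidean inner product of the entries of \<open>A\<close>
  with those of the transpose of \<open>B\<close>, so the scalar Cauchy--Schwarz inequality over
  index pairs applies.\<close>

lemma tr_Cauchy_Schwarz:
  "(tr (A * B))\<^sup>2 \<le> tr (A * adj A) * tr (B * adj B)"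
proof -
  let ?a = "\<lambda>(i, j). mat_of A $ i $ j" and ?b = "\<lambda>(i, j). mat_of B $ j $ i"
  have "tr (A * B) = (\<Sum>p\<in>UNIV. ?a p * ?b p)"
    by (simp add: tr.rep_eq times_sqmat.rep_eq trace_def matrix_matrix_mult_def
        sum.cartesian_product case_prod_unfold)
  moreover have "tr (A * adj A) = (\<Sum>p\<in>UNIV. (?a p)\<^sup>2)"
    by (simp add: tr_mult_adj sum.cartesian_product case_prod_unfold)
  moreover have "tr (B * adj B) = (\<Sum>p\<in>UNIV. (?b p)\<^sup>2)"
    by (subst tr_mult_adj, subst sum.swap) (simp add: sum.cartesian_product case_prod_unfold)
  ultimately show ?thesis
    by (simp only: Cauchy_Schwarz_ineq_sum)
qed

section \<open>The Golden--Thompson inequality\<close>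

lemma tr_power_commute: "tr ((A * B) ^ n) = tr ((B * A) ^ n)"
proof (cases n)
  case (Suc m)
  \<comment> \<open>Pulling \<open>A\<close> to the front turns the powers of \<open>A * B\<close>
    into powers of \<open>B * A\<close>; cyclicity of the trace then moves the last
    \<open>B\<close>.\<close>
  have shift: "(A * B) ^ m * A = A * (B * A) ^ m"
    by (induction m) (simp_all add: mult.assoc)
  have "tr ((A * B) ^ n) = tr ((A * B) ^ m * A * B)"
    by (simp add: Suc power_Suc2 mult.assoc del: power_Suc)
  also have "\<dots> = tr (A * (B * A) ^ m * B)"
    by (simp only: shift)
  also have "\<dots> = tr (B * A * (B * A) ^ m)"
    using tr_mult_commute[of "A * (B * A) ^ m" B] by (simp only: mult.assoc)
  finally show ?thesis
    by (simp add: Suc)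
qed simp

text \<open>The power of the Schatten norm of exponent \<open>2 ^ Suc k\<close>.\<close>

definition schatten :: "nat \<Rightarrow> 'd::finite sqmat \<Rightarrow> real" where
  "schatten k A = tr ((A * adj A) ^ 2 ^ k)"

lemma schatten_Suc: "schatten (Suc k) A = schatten k (A * adj A)"
  by (simp add: schatten_def adj_mult power_mult power2_eq_square)

lemma schatten_adj: "schatten k (adj A) = schatten k A"
  by (simp add: schatten_def tr_power_commute[of A])

text \<open>For \<open>k = 0\<close> this is a squared Frobenius norm. Otherwise the exponent is
  even, and an even power of the self-adjoint \<open>A * adj A\<close> has the form
  \<open>C * adj C\<close>.\<close>

lemma schatten_nonneg: "0 \<le> schatten k A"
proof (cases k)
  case 0
  then show ?thesis by (simp add: schatten_def tr_mult_adj_nonneg)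
next
  case (Suc l)
  have "schatten k A = tr ((A * adj A) ^ 2 ^ l * adj ((A * adj A) ^ 2 ^ l))"
    unfolding schatten_def Suc power_Suc mult_2 power_add adj_power adj_mult adj_adj ..
  then show ?thesis by (simp add: tr_mult_adj_nonneg)
qed

text \<open>Cyclicity brings the final \<open>adj A\<close> to the front. The result is an
  alternating word in two factors, the shape required by the induction below.\<close>

lemma schatten_mult: "schatten k (A * B) = tr ((adj A * A * (B * adj B)) ^ 2 ^ k)"
  using tr_power_commute[of "A * (B * adj B)" "adj A" "2 ^ k"]
  by (simp add: schatten_def adj_mult mult.assoc)

text \<open>Grouping consecutive factors into pairs doubles the exponent, and a Schatten norm of a
  product of two factors is again a trace of an alternating word.\<close>

lemma tr_power_mult_le: "(tr ((A * B) ^ 2 ^ k))\<^sup>2 \<le> schatten k A * schatten k B"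
proof (induction k arbitrary: A B)
  case 0
  show ?case
    using tr_Cauchy_Schwarz[of A B] by (simp add: schatten_def)
next
  case (Suc k)
  \<comment> \<open>The induction hypothesis enters twice: here with both factors equal to
    \<open>A * B\<close>, then with \<open>adj A * A\<close> and \<open>B * adj B\<close>.\<close>
  have "(tr ((A * B * (A * B)) ^ 2 ^ k))\<^sup>2 \<le> (schatten k (A * B))\<^sup>2"
    using Suc.IH[of "A * B" "A * B"] by (simp add: power2_eq_square)
  also have "\<dots> \<le> schatten k (adj A * A) * schatten k (B * adj B)"
    unfolding schatten_mult[of k A B] by (rule Suc.IH)
  also have "\<dots> = schatten (Suc k) A * schatten (Suc k) B"
    using schatten_Suc[of k "adj A"] by (simp add: schatten_Suc[of k B] schatten_adj)
  finally show ?case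
    by (simp add: power_mult power2_eq_square)
qed

text \<open>For self-adjoint factors the Schatten power of \<open>A * B\<close> is the trace of a
  power of \<open>A\<^sup>2 * B\<^sup>2\<close>, so the induction continues with the squares in
  place of \<open>A\<close> and \<open>B\<close>.\<close>

lemma tr_power_mult_self_adjoint_le:
  assumes "adj A = A" "adj B = B"
  shows "tr ((A * B) ^ 2 ^ m) \<le> tr (A ^ 2 ^ m * B ^ 2 ^ m)"
  using assms
proof (induction m arbitrary: A B)
  case (Suc m)
  have "(tr ((A * B * (A * B)) ^ 2 ^ m))\<^sup>2 \<le> (schatten m (A * B))\<^sup>2"
    using tr_power_mult_le[of "A * B" "A * B" m] by (simp add: power2_eq_square)
  \<comment> \<open>Taking roots is legitimate whatever the sign of the trace, because the Schatten
    power is nonnegative.\<close>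
  then have "tr ((A * B) ^ 2 ^ Suc m) \<le> schatten m (A * B)"
    using power2_le_imp_le[OF _ schatten_nonneg]
    by (simp only: power_Suc power_mult power2_eq_square[of "A * B"])
  also have "\<dots> = tr ((A\<^sup>2 * B\<^sup>2) ^ 2 ^ m)"
    by (simp add: schatten_mult Suc.prems power2_eq_square)
  also have "\<dots> \<le> tr ((A\<^sup>2) ^ 2 ^ m * (B\<^sup>2) ^ 2 ^ m)"
    by (rule Suc.IH) (simp_all add: adj_power Suc.prems)
  finally show ?case
    by (simp add: power_mult)
qed simp

section \<open>The Lie--Trotter product formula\<close>

lemma norm_power_diff_le:
  fixes x y :: "'a::real_normed_algebra_1"
  assumes "norm x \<le> c" "norm y \<le> c"
  shows "norm (x ^ Suc n - y ^ Suc n) \<le> real (Suc n) * c ^ n * norm (x - y)"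
proof (induction n)
  case (Suc n)
  have c: "0 \<le> c"
    using assms(1) norm_ge_zero order_trans by blast
  \<comment> \<open>Telescoping: replace one factor \<open>x\<close> by \<open>y\<close> at a time,
    without assuming that they commute.\<close>
  have "x ^ Suc (Suc n) - y ^ Suc (Suc n) = x * (x ^ Suc n - y ^ Suc n) + (x - y) * y ^ Suc n"
    by (simp add: algebra_simps)
  also have "norm \<dots> \<le> norm x * norm (x ^ Suc n - y ^ Suc n) + norm (x - y) * norm (y ^ Suc n)"
    by (intro norm_triangle_le add_mono norm_mult_ineq)
  also have "\<dots> \<le> c * (real (Suc n) * c ^ n * norm (x - y)) + norm (x - y) * c ^ Suc n"
    by (intro add_mono mult_mono Suc.IH assms c mult_nonneg_nonneg
        order_trans[OF norm_power_ineq] power_mono) auto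
  also have "\<dots> = real (Suc (Suc n)) * c ^ Suc n * norm (x - y)"
    by (simp add: algebra_simps)
  finally show ?case .
qed simp

lemma exp_divide_power:
  fixes A :: "'a::{real_normed_algebra_1, banach}"
  assumes "0 < n"
  shows "exp (A /\<^sub>R real n) ^ n = exp A"
proof -
  have "exp (A /\<^sub>R real n) ^ k = exp ((real k / real n) *\<^sub>R A)" for k
  proof (induction k)
    case (Suc k)
    have "exp (A /\<^sub>R real n) ^ Suc k = exp (A /\<^sub>R real n) * exp ((real k / real n) *\<^sub>R A)"
      by (simp add: Suc)
    also have "\<dots> = exp (A /\<^sub>R real n + (real k / real n) *\<^sub>R A)"
      by (rule exp_add_commuting[symmetric]) simp
    also have "A /\<^sub>R real n + (real k / real n) *\<^sub>R A = (real (Suc k) / real n) *\<^sub>R A"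
      by (simp add: divide_inverse algebra_simps)
    finally show ?case .
  qed simp
  from this[of n] show ?thesis
    using assms by simp
qed

text \<open>Both limits come from the derivative and the continuity of
  \<open>exp (t *\<^sub>R A)\<close> in \<open>t\<close> at 0, sampled at
  \<open>t = 1 / n\<close>.\<close>

lemma exp_divide_tendsto:
  fixes A :: "'a::{real_normed_algebra_1, banach}"
  shows "(\<lambda>n. real n *\<^sub>R (exp (A /\<^sub>R real n) - 1)) \<longlonglongrightarrow> A"
    and "(\<lambda>n. exp (A /\<^sub>R real n)) \<longlonglongrightarrow> 1"
proof -
  have deriv: "((\<lambda>t. exp (t *\<^sub>R A)) has_vector_derivative A) (at 0)"
    using exp_scaleR_has_vector_derivative_right[of A 0 UNIV] by simp
  then have "((\<lambda>t. norm (exp (t *\<^sub>R A) - 1 - t *\<^sub>R A) / norm t) \<longlongrightarrow> 0) (at 0)"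
    by (simp add: has_vector_derivative_def has_derivative_at)
  moreover have "norm (exp (t *\<^sub>R A) - 1 - t *\<^sub>R A) / norm t = norm ((exp (t *\<^sub>R A) - 1) /\<^sub>R t - A)"
    if "t \<noteq> 0" for t
  proof -
    have "(exp (t *\<^sub>R A) - 1) /\<^sub>R t - A = (exp (t *\<^sub>R A) - 1 - t *\<^sub>R A) /\<^sub>R t"
      using that by (simp add: scaleR_diff_right)
    then show ?thesis
      by (simp add: divide_inverse_commute)
  qed
  ultimately have "((\<lambda>t. norm ((exp (t *\<^sub>R A) - 1) /\<^sub>R t - A)) \<longlongrightarrow> 0) (at 0)"
    by (auto elim!: Lim_transform_eventually simp: eventually_at_filter)
  then have lim: "((\<lambda>t. (exp (t *\<^sub>R A) - 1) /\<^sub>R t) \<longlongrightarrow> A) (at 0)"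
    by (rule LIM_zero_cancel[OF tendsto_norm_zero_cancel])
  have inv: "filterlim (\<lambda>n. inverse (real n)) (at 0) sequentially"
    by (rule filterlim_mono[OF filterlim_compose[OF filterlim_inverse_at_right_top filterlim_real_sequentially]])
      (simp_all add: at_le)
  from filterlim_compose[OF lim inv]
  show "(\<lambda>n. real n *\<^sub>R (exp (A /\<^sub>R real n) - 1)) \<longlonglongrightarrow> A"
    by simp
  have "((\<lambda>t. exp (t *\<^sub>R A)) \<longlongrightarrow> 1) (at 0)"
    using has_vector_derivative_continuous[OF deriv] by (simp add: continuous_at)
  from filterlim_compose[OF this inv] show "(\<lambda>n. exp (A /\<^sub>R real n)) \<longlonglongrightarrow> 1" .
qed

text \<open>Compare with \<open>Y n\<close>, whose \<open>n\<close>-th power is exactly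
  \<open>exp (H + K)\<close>. By telescoping, the \<open>n\<close>-th powers differ by at most a
  constant times \<open>n\<close> times the distance of the bases, and the bases agree to first
  order.\<close>

lemma Lie_Trotter:
  fixes H K :: "'a::{real_normed_algebra_1, banach}"
  shows "(\<lambda>n. (exp (H /\<^sub>R real n) * exp (K /\<^sub>R real n)) ^ n) \<longlonglongrightarrow> exp (H + K)"
proof -
  define X where "X n = exp (H /\<^sub>R real n) * exp (K /\<^sub>R real n)" for n
  define Y where "Y n = exp ((H + K) /\<^sub>R real n)" for n
  define C where "C = exp (norm H + norm K)"
  define D where "D n = real n *\<^sub>R (X n - Y n)" for n
  \<comment> \<open>Adding and subtracting 1 splits \<open>D\<close> into three difference
    quotients, with limits \<open>H\<close>, \<open>K\<close> and \<open>H + K\<close>.\<close>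
  have "D = (\<lambda>n. real n *\<^sub>R (exp (H /\<^sub>R real n) - 1) * exp (K /\<^sub>R real n)
      + real n *\<^sub>R (exp (K /\<^sub>R real n) - 1) - real n *\<^sub>R (exp ((H + K) /\<^sub>R real n) - 1))"
    by (rule ext) (simp add: D_def X_def Y_def left_diff_distrib scaleR_diff_right)
  also have "\<dots> \<longlonglongrightarrow> H * 1 + K - (H + K)"
    by (intro tendsto_intros exp_divide_tendsto)
  finally have D: "D \<longlonglongrightarrow> 0"
    by simp
  have bound: "norm (X n ^ n - Y n ^ n) \<le> C * norm (D n)" if "n > 0" for n
  proof -
    obtain m where n: "n = Suc m"
      using \<open>n > 0\<close> by (cases n) auto
    define c where "c = exp ((norm H + norm K) / real n)"
    have 1: "norm (X n) \<le> c"
    proof -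
      have "norm (X n) \<le> exp (norm (H /\<^sub>R real n)) * exp (norm (K /\<^sub>R real n))"
        unfolding X_def by (intro order_trans[OF norm_mult_ineq] mult_mono norm_exp) auto
      also have "\<dots> = c"
        by (simp add: c_def divide_inverse_commute ring_distribs mult_exp_exp)
      finally show ?thesis .
    qed
    have 2: "norm (Y n) \<le> c"
    proof -
      have "norm (Y n) \<le> exp (norm ((H + K) /\<^sub>R real n))"
        unfolding Y_def by (rule norm_exp)
      also have "\<dots> \<le> c"
        using norm_triangle_ineq[of H K] by (simp add: c_def divide_inverse_commute mult_left_mono)
      finally show ?thesis .
    qed
    \<comment> \<open>Here \<open>m = n - 1\<close>, so the \<open>n\<close> in the exponent of
      \<open>c\<close> cancels and the bound is uniform in \<open>n\<close>.\<close>
    have "c ^ m \<le> C"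
    proof -
      have "c ^ m = exp (real m / real n * (norm H + norm K))"
        by (simp add: c_def exp_of_nat_mult[symmetric])
      also have "\<dots> \<le> C"
        unfolding C_def exp_le_cancel_iff by (rule mult_left_le_one_le) (simp_all add: n)
      finally show ?thesis .
    qed
    have "norm (X n ^ n - Y n ^ n) \<le> real n * c ^ m * norm (X n - Y n)"
      using norm_power_diff_le[OF 1 2, of m] by (simp only: n)
    also have "\<dots> \<le> real n * C * norm (X n - Y n)"
      using \<open>c ^ m \<le> C\<close> by (intro mult_right_mono mult_left_mono) auto
    finally show ?thesis
      by (simp add: D_def mult_ac)
  qed
  have "(\<lambda>n. X n ^ n - Y n ^ n) \<longlonglongrightarrow> 0"
  proof (rule Lim_null_comparison)
    show "\<forall>\<^sub>F n in sequentially. norm (X n ^ n - Y n ^ n) \<le> C * norm (D n)"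
      using eventually_gt_at_top[of 0] by eventually_elim (rule bound)
    show "(\<lambda>n. C * norm (D n)) \<longlonglongrightarrow> 0"
      using tendsto_mult[OF tendsto_const[of C] tendsto_norm[OF D]] by simp
  qed
  moreover have "\<forall>\<^sub>F n in sequentially. X n ^ n - Y n ^ n = X n ^ n - exp (H + K)"
    using eventually_gt_at_top[of 0] by eventually_elim (simp add: Y_def exp_divide_power)
  ultimately have "(\<lambda>n. X n ^ n - exp (H + K)) \<longlonglongrightarrow> 0"
    by (rule Lim_transform_eventually)
  then show ?thesis
    unfolding X_def by (rule LIM_zero_cancel)
qed

lemma adj_exp:
  assumes "adj A = A"
  shows "adj (exp A) = exp A"
proof -
  have "(\<lambda>n. adj (A ^ n /\<^sub>R fact n)) sums adj (exp A)"
    by (rule bounded_linear.sums[OF bounded_linear_adj exp_converges])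
  then show ?thesis
    using exp_converges[of A] by (simp add: adj_scaleR adj_power assms sums_unique2)
qed

theorem Golden_Thompson:
  assumes "adj H = H" "adj K = K"
  shows "tr (exp (H + K)) \<le> tr (exp H * exp K)"
proof (rule Lim_bounded)
  \<comment> \<open>The trace inequality is available for exponents \<open>2 ^ m\<close>, so the
    limit is taken along that subsequence; the right-hand side is the same for every
    \<open>m\<close>.\<close>
  have "(\<lambda>m. (exp (H /\<^sub>R real (2 ^ m)) * exp (K /\<^sub>R real (2 ^ m))) ^ 2 ^ m) \<longlonglongrightarrow> exp (H + K)"
    by (rule filterlim_compose[OF Lie_Trotter filterlim_subseq]) (simp add: strict_mono_def)
  then show "(\<lambda>m. tr ((exp (H /\<^sub>R real (2 ^ m)) * exp (K /\<^sub>R real (2 ^ m))) ^ 2 ^ m))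
      \<longlonglongrightarrow> tr (exp (H + K))"
    by (rule bounded_linear.tendsto[OF bounded_linear_tr])
  have "tr ((exp (H /\<^sub>R real (2 ^ m)) * exp (K /\<^sub>R real (2 ^ m))) ^ 2 ^ m) \<le> tr (exp H * exp K)" for m
    using tr_power_mult_self_adjoint_le[of "exp (H /\<^sub>R real (2 ^ m))" "exp (K /\<^sub>R real (2 ^ m))" m]
    by (simp add: exp_divide_power adj_exp adj_scaleR assms del: of_nat_power)
  then show "\<forall>m\<ge>0. tr ((exp (H /\<^sub>R real (2 ^ m)) * exp (K /\<^sub>R real (2 ^ m))) ^ 2 ^ m)
      \<le> tr (exp H * exp K)"
    by blast
qed

section \<open>Spectral estimates\<close>

lemma app_mult: "app (A * B) v = app A (app B v)"
  by transfer (simp add: matrix_vector_mul_assoc)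

lemma app_one [simp]: "app 1 v = v"
  by transfer simp

lemma linear_app: "linear (app A)"
  by transfer simp

lemma norm_app_le: "norm (app A v) \<le> norm A * norm v"
  by transfer (simp add: onorm)

lemma bounded_linear_app_left: "bounded_linear (\<lambda>A. app A v)"
proof (rule bounded_linear_intro)
  show "norm (app A v) \<le> norm A * norm v" for A
    by (rule norm_app_le)
qed (transfer; simp add: matrix_vector_mult_add_rdistrib scaleR_matrix_vector_assoc)+

lemma app_scaleR_left: "app (c *\<^sub>R A) v = c *\<^sub>R app A v"
  by (rule linear_scale[OF bounded_linear.linear[OF bounded_linear_app_left]])

lemma inner_app_adj: "app A v \<bullet> w = v \<bullet> app (adj A) w"
  by transfer (metis dot_lmul_matrix inner_commute transpose_matrix_vector)

text \<open>The unit sphere is compact, and by homogeneity the maximum over it bounds the operator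
  norm.\<close>

lemma norm_attained:
  obtains v where "norm v = 1" "norm (app A v) = norm A"
proof -
  have "compact (sphere 0 1 :: (real ^ 'd) set)" "sphere 0 1 \<noteq> ({} :: (real ^ 'd) set)"
    by simp_all
  moreover have "continuous_on (sphere 0 1) (\<lambda>v. norm (app A v))"
    by (intro continuous_on_norm linear_continuous_on linear_conv_bounded_linear[THEN iffD1] linear_app)
  ultimately obtain v where v: "v \<in> sphere 0 1" "\<forall>w\<in>sphere 0 1. norm (app A w) \<le> norm (app A v)"
    using continuous_attains_sup by blast
  have "norm (app A w) \<le> norm (app A v) * norm w" for w
  proof (cases "w = 0")
    case True
    then show ?thesis
      by (simp add: linear_0[OF linear_app])
  next
    case False
    then have "norm (app A (w /\<^sub>R norm w)) \<le> norm (app A v)"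
      using v by simp
    then show ?thesis
      using False by (simp add: linear_scale[OF linear_app] field_simps)
  qed
  then have "norm A \<le> norm (app A v)"
    by (simp add: norm_sqmat.rep_eq app.rep_eq onorm_le)
  with norm_app_le[of A v] v that show ?thesis
    by force
qed

text \<open>If \<open>v\<close> maximises \<open>\<parallel>A v\<parallel>\<close> on the unit sphere, then \<open>A\<^sup>2 v = \<parallel>A\<parallel>\<^sup>2 v\<close>, and one of the
  factors of \<open>(A - \<parallel>A\<parallel>) (A + \<parallel>A\<parallel>) v = 0\<close> yields the eigenvector.\<close>

lemma norm_eigenvalue:
  assumes "adj A = A"
  obtains w l where "w \<noteq> 0" "app A w = l *\<^sub>R w" "\<bar>l\<bar> = norm A"
proof -
  obtain v where v: "norm v = 1" "norm (app A v) = norm A"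
    by (rule norm_attained)
  let ?l = "norm A"
  let ?u = "app A (app A v)"
  \<comment> \<open>Self-adjointness makes the cross term
    \<open>\<parallel>A v\<parallel>\<^sup>2\<close>, so the square collapses to
    \<open>\<parallel>A\<^sup>2 v\<parallel>\<^sup>2 - \<parallel>A\<parallel>\<^sup>4\<close>,
    which cannot be positive.\<close>
  have "norm (?u - ?l\<^sup>2 *\<^sub>R v) ^ 2 = norm ?u ^ 2 - 2 * ?l\<^sup>2 * (app A v \<bullet> app A v) + ?l\<^sup>2 * ?l\<^sup>2 * (v \<bullet> v)"
    using inner_app_adj[of A "app A v" v]
    by (simp add: assms power2_norm_eq_inner inner_diff_left inner_diff_right inner_commute)
  also have "\<dots> = norm ?u ^ 2 - ?l ^ 4"
    using v by (simp flip: power2_norm_eq_inner)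
  also have "\<dots> \<le> 0"
    using power_mono[OF norm_app_le[of A "app A v"], of 2] v
    by (simp add: power_numeral_reduce algebra_simps)
  finally have sq: "?u = ?l\<^sup>2 *\<^sub>R v"
    by simp
  show ?thesis
  proof (cases "app A v + ?l *\<^sub>R v = 0")
    case True
    then have "app A v = (- ?l) *\<^sub>R v"
      by (simp add: eq_neg_iff_add_eq_0)
    with v that[of v "- ?l"] show ?thesis
      by force
  next
    case False
    have "app A (app A v + ?l *\<^sub>R v) = ?l *\<^sub>R (app A v + ?l *\<^sub>R v)"
      by (simp add: linear_add[OF linear_app] linear_scale[OF linear_app] sq power2_eq_square algebra_simps)
    with False that show ?thesis
      by force
  qed
qed

lemma app_exp_eigenvector:
  assumes "app A w = l *\<^sub>R w"
  shows "app (exp A) w = exp l *\<^sub>R w"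
proof -
  have "app (A ^ n) w = l ^ n *\<^sub>R w" for n
    by (induction n) (simp_all add: app_mult assms linear_scale[OF linear_app] mult.commute)
  moreover have "(\<lambda>n. app (A ^ n /\<^sub>R fact n) w) sums app (exp A) w"
    by (rule bounded_linear.sums[OF bounded_linear_app_left exp_converges])
  ultimately have "(\<lambda>n. (l ^ n /\<^sub>R fact n) *\<^sub>R w) sums app (exp A) w"
    by (simp add: app_scaleR_left)
  moreover have "(\<lambda>n. (l ^ n /\<^sub>R fact n) *\<^sub>R w) sums (exp l *\<^sub>R w)"
    by (rule bounded_linear.sums[OF bounded_linear_scaleR_left exp_converges])
  ultimately show ?thesis
    by (rule sums_unique2)
qed

lemma norm_vec_power2: "(norm v)\<^sup>2 = (\<Sum>i\<in>UNIV. (v $ i)\<^sup>2)" for v :: "real ^ 'd"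
  unfolding power2_norm_eq_inner inner_vec_def by (simp add: power2_eq_square)

text \<open>Operator norm against Frobenius norm: Cauchy--Schwarz in each row.\<close>

lemma norm_power2_le_tr: "(norm A)\<^sup>2 \<le> tr (A * adj A)"
proof -
  let ?s = "tr (A * adj A)"
  have "(norm (app A v))\<^sup>2 \<le> ?s * (norm v)\<^sup>2" for v
  proof -
    have "(norm (app A v))\<^sup>2 = (\<Sum>i\<in>UNIV. (\<Sum>j\<in>UNIV. mat_of A $ i $ j * v $ j)\<^sup>2)"
      by (simp add: norm_vec_power2 app.rep_eq matrix_vector_mult_def)
    also have "\<dots> \<le> (\<Sum>i\<in>UNIV. (\<Sum>j\<in>UNIV. (mat_of A $ i $ j)\<^sup>2) * (\<Sum>j\<in>UNIV. (v $ j)\<^sup>2))"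
      by (intro sum_mono Cauchy_Schwarz_ineq_sum)
    also have "\<dots> = ?s * (norm v)\<^sup>2"
      by (simp add: tr_mult_adj norm_vec_power2 sum_distrib_right)
    finally show ?thesis .
  qed
  moreover obtain v where "norm v = 1" "norm (app A v) = norm A"
    by (rule norm_attained)
  ultimately show ?thesis
    by (metis mult.right_neutral one_power2)
qed

text \<open>Each of the d columns is the image of a unit vector. This factor d is the source of the
  \<open>sqrt d\<close> in the Frobenius bound.\<close>

lemma tr_mult_adj_le: "tr (A * adj A) \<le> real CARD('d) * (norm A)\<^sup>2" for A :: "'d::finite sqmat"
proof -
  have "tr (A * adj A) = (\<Sum>j\<in>UNIV. (norm (column j (mat_of A)))\<^sup>2)"
    by (subst tr_mult_adj, subst sum.swap) (simp add: norm_vec_power2 column_def)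
  also have "\<dots> \<le> (\<Sum>j\<in>(UNIV :: 'd set). (norm A)\<^sup>2)"
    by (intro sum_mono power_mono) (simp_all add: norm_sqmat.rep_eq norm_column_le_onorm)
  finally show ?thesis
    by simp
qed

text \<open>Writing the exponential as the square of a self-adjoint matrix makes its trace a squared
  Frobenius norm, which replaces a spectral decomposition in what follows.\<close>

lemma tr_exp_self_adjoint:
  assumes "adj A = A"
  shows "tr (exp A) = tr (exp (A /\<^sub>R 2) * adj (exp (A /\<^sub>R 2)))"
  using exp_divide_power[of 2 A] by (simp add: adj_exp adj_scaleR assms power2_eq_square)

lemma tr_exp_nonneg: "adj A = A \<Longrightarrow> 0 \<le> tr (exp A)"
  by (simp add: tr_exp_self_adjoint tr_mult_adj_nonneg)

text \<open>The matrix \<open>exp (A /\<^sub>R 2)\<close> has eigenvalue \<open>exp (l / 2)\<close>,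
  which is at most its operator norm and hence its Frobenius norm; squaring gives the trace.\<close>

lemma exp_eigenvalue_le_tr_exp:
  assumes "adj A = A" "app A w = l *\<^sub>R w" "w \<noteq> 0"
  shows "exp l \<le> tr (exp A)"
proof -
  have "app (exp (A /\<^sub>R 2)) w = exp (l / 2) *\<^sub>R w"
    by (rule app_exp_eigenvector) (simp add: app_scaleR_left assms)
  then have "exp (l / 2) \<le> norm (exp (A /\<^sub>R 2))"
    using norm_app_le[of "exp (A /\<^sub>R 2)" w] assms(3) by simp
  then have "(exp (l / 2))\<^sup>2 \<le> (norm (exp (A /\<^sub>R 2)))\<^sup>2"
    by (intro power_mono) auto
  also have "\<dots> \<le> tr (exp A)"
    unfolding tr_exp_self_adjoint[OF assms(1)] by (rule norm_power2_le_tr)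
  finally show ?thesis
    by (simp flip: exp_double)
qed

text \<open>The eigenvalue of modulus \<open>norm A\<close> can have either sign, so one of the two
  traces dominates and the other is nonnegative. Having two traces produces the factor 2 in the tail
  bounds.\<close>

lemma exp_norm_le_tr_exp:
  assumes "adj A = A" "0 \<le> t"
  shows "exp (t * norm A) \<le> tr (exp (t *\<^sub>R A)) + tr (exp ((- t) *\<^sub>R A))"
proof -
  obtain w l where w: "w \<noteq> 0" "app A w = l *\<^sub>R w" "\<bar>l\<bar> = norm A"
    using norm_eigenvalue[OF assms(1)] .
  have adj: "adj (s *\<^sub>R A) = s *\<^sub>R A" for s
    by (simp add: adj_scaleR assms)
  have le: "exp (s * l) \<le> tr (exp (s *\<^sub>R A))" for s
    by (rule exp_eigenvalue_le_tr_exp[OF adj _ w(1)]) (simp add: app_scaleR_left w)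
  have "exp (t * norm A) = exp (t * l) \<or> exp (t * norm A) = exp (- t * l)"
    unfolding w(3)[symmetric] by (cases "0 \<le> l") simp_all
  then show ?thesis
    using add_mono[OF le[of t] tr_exp_nonneg[OF adj, of "- t"]] add_mono[OF tr_exp_nonneg[OF adj, of t] le[of "- t"]]
    by (elim disjE) (simp_all only: add_0_left add_0_right)
qed

section \<open>Exponentials of rank-one matrices\<close>

lemma exp_idempotent:
  fixes P :: "'a::{real_normed_algebra_1, banach}"
  assumes "P * P = P"
  shows "exp (c *\<^sub>R P) = 1 + (exp c - 1) *\<^sub>R P"
proof -
  have pow: "P ^ Suc n = P" for n
    by (induction n) (simp_all add: assms)
  have scale: "(c *\<^sub>R P) ^ n = c ^ n *\<^sub>R P ^ n" for n
    by (induction n) simp_all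
  \<comment> \<open>The series agrees with that of \<open>exp c *\<^sub>R P\<close> except at
    \<open>n = 0\<close>, where the term is 1 instead of \<open>P\<close>.\<close>
  have "(c *\<^sub>R P) ^ n /\<^sub>R fact n = (if n = 0 then 1 - P else 0) + (c ^ n /\<^sub>R fact n) *\<^sub>R P" for n
    using pow[of "n - 1"] by (cases n) (simp_all add: scale del: power_Suc)
  moreover have "(\<lambda>n. (if n = 0 then 1 - P else 0) + (c ^ n /\<^sub>R fact n) *\<^sub>R P) sums ((1 - P) + exp c *\<^sub>R P)"
    by (intro sums_add sums_single bounded_linear.sums[OF bounded_linear_scaleR_left exp_converges])
  ultimately show ?thesis
    using exp_converges[of "c *\<^sub>R P"] sums_unique2 by (fastforce simp: algebra_simps)
qed

definition outer :: "real ^ 'd \<Rightarrow> 'd::finite sqmat" where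
  "outer x = sq_of (\<chi> i j. x $ i * x $ j)"

lemma mat_of_outer: "mat_of (outer x) = (\<chi> i j. x $ i * x $ j)"
  by (simp add: outer_def sq_of_inverse)

lemma adj_outer [simp]: "adj (outer x) = outer x"
  by (simp add: outer_def adj.abs_eq transpose_def vec_eq_iff mult.commute)

lemma outer_zero [simp]: "outer 0 = 0"
  by (simp add: outer_def zero_sqmat_def zero_vec_def)

lemma outer_mult_self: "outer x * outer x = (x \<bullet> x) *\<^sub>R outer x"
  by (simp add: outer_def times_sqmat.abs_eq scaleR_sqmat.abs_eq sq_of_inject vec_eq_iff
      matrix_matrix_mult_def inner_vec_def sum_distrib_left sum_distrib_right mult_ac)

lemma tr_mult_outer: "tr (A * outer x) = (\<Sum>i\<in>UNIV. \<Sum>j\<in>UNIV. mat_of A $ i $ j * (x $ i * x $ j))"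
  by (simp add: tr.rep_eq times_sqmat.rep_eq mat_of_outer trace_def matrix_matrix_mult_def mult_ac)

text \<open>For nonzero \<open>x\<close>, dividing \<open>outer x\<close> by
  \<open>x \<bullet> x\<close> gives a projection. For \<open>x = 0\<close> both sides are 1, as
  \<open>outer 0\<close> vanishes.\<close>

lemma exp_scaleR_outer: "exp (t *\<^sub>R outer x) = 1 + ((exp (t * (x \<bullet> x)) - 1) / (x \<bullet> x)) *\<^sub>R outer x"
proof (cases "x = 0")
  case False
  define P where "P = outer x /\<^sub>R (x \<bullet> x)"
  have "P * P = P"
    using False by (simp add: P_def outer_mult_self)
  moreover have "t *\<^sub>R outer x = (t * (x \<bullet> x)) *\<^sub>R P"
    using False by (simp add: P_def)
  ultimately show ?thesis
    by (simp add: exp_idempotent) (simp add: P_def divide_inverse)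
qed simp

lemma exp_scaleR_one: "exp (c *\<^sub>R 1 :: 'a::{real_normed_algebra_1, banach}) = exp c *\<^sub>R 1"
  using exp_of_real[of c, where 'a = 'a] by (simp add: of_real_def)

lemma exp_scaleR_outer_diff:
  "exp (t *\<^sub>R (outer x - s *\<^sub>R 1))
    = exp (- t * s) *\<^sub>R (1 + ((exp (t * (x \<bullet> x)) - 1) / (x \<bullet> x)) *\<^sub>R outer x)"
proof -
  have "exp (t *\<^sub>R (outer x - s *\<^sub>R 1)) = exp ((- t * s) *\<^sub>R 1 + t *\<^sub>R outer x)"
    by (simp add: algebra_simps)
  also have "\<dots> = exp ((- t * s) *\<^sub>R 1) * exp (t *\<^sub>R outer x)"
    by (rule exp_add_commuting) simp
  finally show ?thesis
    by (simp only: exp_scaleR_one exp_scaleR_outer) simp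
qed

section \<open>Moments of the uniform distribution on a ball\<close>

abbreviation (input) unif_ball :: "real \<Rightarrow> 'a::euclidean_space measure" where
  "unif_ball r \<equiv> uniform_measure lborel (cball 0 r)"

lemma unit_ball_vol_neq_0: "0 \<le> n \<Longrightarrow> unit_ball_vol n \<noteq> 0"
  by (metis unit_ball_vol_pos less_irrefl)

lemma emeasure_cball_neq:
  assumes "0 < r"
  shows "emeasure lborel (cball (0::'a::euclidean_space) r) \<noteq> 0" "emeasure lborel (cball (0::'a) r) \<noteq> \<infinity>"
  using assms by (simp_all add: emeasure_cball unit_ball_vol_neq_0)

lemma prob_space_unif_ball: "0 < r \<Longrightarrow> prob_space (unif_ball r)"
  by (intro prob_space_uniform_measure emeasure_cball_neq)

lemma AE_unif_ball: "0 < r \<Longrightarrow> AE x in unif_ball r. norm x \<le> r"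
  by (intro AE_uniform_measureI) auto

lemma integrable_unif_ball:
  fixes f :: "'a::euclidean_space \<Rightarrow> real"
  assumes "0 < r" "f \<in> borel_measurable borel" "\<And>x. norm x \<le> r \<Longrightarrow> \<bar>f x\<bar> \<le> C"
  shows "integrable (unif_ball r) f"
proof -
  interpret prob_space "unif_ball r :: 'a measure"
    by (rule prob_space_unif_ball[OF assms(1)])
  show ?thesis
    using assms AE_unif_ball[OF assms(1)]
    by (intro integrable_const_bound[where B = C]) auto
qed

text \<open>Layer cake: \<open>r\<^sup>2 - \<parallel>x\<parallel>\<^sup>2\<close> is the integral of \<open>2 s\<close> over \<open>\<parallel>x\<parallel> \<le> s \<le> r\<close>.\<close>

lemma nn_integral_cball_defect:
  fixes r :: real
  assumes "0 < r"
  shows "(\<integral>\<^sup>+x. ennreal (r\<^sup>2 - x \<bullet> x) * indicator (cball (0::'a::euclidean_space) r) x \<partial>lborel)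
    = ennreal (2 * unit_ball_vol (real DIM('a)) * r ^ (DIM('a) + 2) / (real DIM('a) + 2))"
  (is "?I = _")
proof -
  let ?V = "unit_ball_vol (real DIM('a))"
  have deriv: "((\<lambda>s. c * s ^ Suc N / (real N + 1)) has_real_derivative c * s ^ N) (at s)" for c s :: real and N
  proof -
    have eq: "c / (real N + 1) * (real (Suc N) * s ^ (Suc N - Suc 0)) = c * s ^ N"
      by (simp add: divide_simps)
    show ?thesis
      using DERIV_cmult[OF DERIV_pow[of "Suc N" s], of "c / (real N + 1)"]
      unfolding eq by (simp only: times_divide_eq_left)
  qed
  \<comment> \<open>Integrating \<open>f\<close> over \<open>s\<close> first gives the defect;
    integrating over \<open>x\<close> first gives \<open>2 * s\<close> times the volume of the ball
    of radius \<open>s\<close>.\<close>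
  define f where "f = (\<lambda>(x :: 'a) s :: real. ennreal (2 * s) * indicator {p. norm (fst p) \<le> snd p \<and> snd p \<le> r} (x, s))"
  have f_meas: "case_prod f \<in> borel_measurable (lborel \<Otimes>\<^sub>M lborel)"
    unfolding f_def by measurable
  have 1: "ennreal (r\<^sup>2 - x \<bullet> x) * indicator (cball 0 r) x = (\<integral>\<^sup>+s. f x s \<partial>lborel)" for x :: 'a
  proof (cases "norm x \<le> r")
    case True
    have "(\<integral>\<^sup>+s. f x s \<partial>lborel) = (\<integral>\<^sup>+s. ennreal (2 * s) * indicator {norm x..r} s \<partial>lborel)"
      by (intro nn_integral_cong) (auto simp: f_def indicator_def)
    also have "\<dots> = ennreal (r\<^sup>2 - (norm x)\<^sup>2)"
      using True
      by (intro nn_integral_FTC_Icc) (auto intro!: derivative_eq_intros order_trans[OF norm_ge_zero])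
    finally show ?thesis
      using True by (simp add: power2_norm_eq_inner)
  next
    case False
    then have "f x s = 0" for s
      by (auto simp: f_def indicator_def)
    with False show ?thesis
      by simp
  qed
  have 2: "(\<integral>\<^sup>+x. f x s \<partial>lborel) = ennreal (2 * ?V * s ^ (DIM('a) + 1)) * indicator {0..r} s" for s
  proof (cases "0 \<le> s \<and> s \<le> r")
    case True
    have "(\<integral>\<^sup>+x. f x s \<partial>lborel) = (\<integral>\<^sup>+x. ennreal (2 * s) * indicator (cball (0::'a) s) x \<partial>lborel)"
      using True by (intro nn_integral_cong) (auto simp: f_def indicator_def)
    also have "\<dots> = ennreal (2 * s) * ennreal (?V * s ^ DIM('a))"
      using True by (simp add: nn_integral_cmult_indicator emeasure_cball)
    finally show ?thesis
      using True by (simp add: ennreal_mult[symmetric] mult_ac)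
  next
    case False
    then have "f x s = 0" for x
      using norm_ge_zero[of x] by (auto simp: f_def indicator_def simp del: norm_ge_zero)
    with False show ?thesis
      by (auto simp: indicator_def)
  qed
  have "?I = (\<integral>\<^sup>+x. \<integral>\<^sup>+s. f x s \<partial>lborel \<partial>lborel)"
    by (simp only: 1)
  also have "\<dots> = (\<integral>\<^sup>+s. \<integral>\<^sup>+x. f x s \<partial>lborel \<partial>lborel)"
    by (rule lborel_pair.Fubini'[symmetric, OF f_meas])
  also have "\<dots> = (\<integral>\<^sup>+s. ennreal (2 * ?V * s ^ (DIM('a) + 1)) * indicator {0..r} s \<partial>lborel)"
    by (simp only: 2)
  also have "\<dots> = ennreal (2 * ?V * r ^ (DIM('a) + 2) / (real DIM('a) + 2) - 2 * ?V * 0 ^ (DIM('a) + 2) / (real DIM('a) + 2))"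
  proof (rule nn_integral_FTC_Icc)
    fix s :: real
    assume "s \<in> {0..r}"
    show "((\<lambda>s. 2 * ?V * s ^ (DIM('a) + 2) / (real DIM('a) + 2)) has_real_derivative 2 * ?V * s ^ (DIM('a) + 1)) (at s)"
      using deriv[of "2 * ?V" "DIM('a) + 1" s] by (simp add: add.commute)
  qed (use assms in auto)
  finally show ?thesis
    by simp
qed

text \<open>Dividing the defect integral by the volume of the ball gives the mean of
  \<open>r\<^sup>2 - x \<bullet> x\<close>. With \<open>r\<^sup>2 = (d + 2) / n\<close> the mean of
  \<open>x \<bullet> x\<close> becomes \<open>d / n\<close>, which explains the radius in the
  theorem.\<close>

lemma integral_unif_ball_inner_self:
  assumes "0 < r"
  shows "(\<integral>x. x \<bullet> x \<partial>(unif_ball r :: 'a::euclidean_space measure)) = real DIM('a) * r\<^sup>2 / (real DIM('a) + 2)"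
proof -
  interpret prob_space "unif_ball r :: 'a measure"
    by (rule prob_space_unif_ball[OF assms(1)])
  let ?V = "unit_ball_vol (real DIM('a))"
  have int: "integrable (unif_ball r :: 'a measure) (\<lambda>x. x \<bullet> x)"
    by (rule integrable_unif_ball[OF assms, where C = "r\<^sup>2"]) (auto simp: dot_square_norm power_mono)
  have "(\<integral>x. r\<^sup>2 - x \<bullet> x \<partial>(unif_ball r :: 'a measure))
      = enn2real (\<integral>\<^sup>+x. ennreal (r\<^sup>2 - x \<bullet> x) \<partial>(unif_ball r :: 'a measure))"
  proof (rule integral_eq_nn_integral)
    show "AE x in (unif_ball r :: 'a measure). 0 \<le> r\<^sup>2 - x \<bullet> x"
      using AE_unif_ball[OF assms] by eventually_elim (simp add: dot_square_norm power_mono)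
  qed simp
  also have "(\<integral>\<^sup>+x. ennreal (r\<^sup>2 - x \<bullet> x) \<partial>(unif_ball r :: 'a measure))
      = ennreal (2 * ?V * r ^ (DIM('a) + 2) / (real DIM('a) + 2)) / ennreal (?V * r ^ DIM('a))"
    using assms by (simp add: nn_integral_uniform_measure nn_integral_cball_defect emeasure_cball)
  also have "2 * ?V * r ^ (DIM('a) + 2) / (real DIM('a) + 2) = 2 * r\<^sup>2 / (real DIM('a) + 2) * (?V * r ^ DIM('a))"
    by (simp add: power_add power2_eq_square)
  also have "ennreal \<dots> / ennreal (?V * r ^ DIM('a)) = ennreal (2 * r\<^sup>2 / (real DIM('a) + 2))"
    using assms by (subst divide_ennreal) (simp_all add: unit_ball_vol_neq_0)
  finally have "(\<integral>x. r\<^sup>2 - x \<bullet> x \<partial>(unif_ball r :: 'a measure)) = 2 * r\<^sup>2 / (real DIM('a) + 2)"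
    by simp
  then have "(\<integral>x. x \<bullet> x \<partial>(unif_ball r :: 'a measure)) = r\<^sup>2 - 2 * r\<^sup>2 / (real DIM('a) + 2)"
    using int prob_space by simp
  then show ?thesis
    by (simp add: field_simps)
qed

section \<open>Coordinate symmetries of the ball\<close>

lemma prod_Basis_cart:
  fixes v :: "real ^ 'd"
  shows "(\<Prod>b\<in>Basis. v \<bullet> b) = (\<Prod>i\<in>UNIV. v $ i)"
proof -
  have Basis: "(Basis :: (real ^ 'd) set) = range (\<lambda>i. axis i 1)"
    by (auto simp: Basis_vec_def)
  show ?thesis
    unfolding Basis by (subst prod.reindex) (simp_all add: inj_on_def axis_eq_axis inner_axis)
qed

text \<open>Lebesgue measure is determined by boxes, and the preimage of a box is a box with the
  same side lengths in another order.\<close>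

lemma lborel_signed_permutation:
  fixes s :: "'d::finite \<Rightarrow> real" and p :: "'d \<Rightarrow> 'd"
  assumes s: "\<And>i. s i = 1 \<or> s i = - 1" and p: "bij p"
  shows "distr lborel borel (\<lambda>x :: real ^ 'd. \<chi> i. s i * x $ p i) = lborel"
proof (rule lborel_eqI[symmetric])
  define T where "T = (\<lambda>x :: real ^ 'd. \<chi> i. s i * x $ p i)"
  have T: "T \<in> borel_measurable borel"
    unfolding T_def by (intro borel_measurable_continuous_onI continuous_intros)
  fix l u :: "real ^ 'd"
  assume "\<And>b. b \<in> Basis \<Longrightarrow> l \<bullet> b \<le> u \<bullet> b"
  then have le: "l $ i \<le> u $ i" for i
    by (metis axis_in_Basis_iff cart_eq_inner_axis insertI1 Basis_real_def)
  \<comment> \<open>Coordinate \<open>j\<close> of the argument lands in coordinate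
    \<open>inv p j\<close>; a sign -1 there negates and exchanges the two bounds.\<close>
  define l' u' where "l' = (\<chi> j. if s (inv p j) = 1 then l $ inv p j else - u $ inv p j)"
    and "u' = (\<chi> j. if s (inv p j) = 1 then u $ inv p j else - l $ inv p j)"
  have inv: "inv p (p i) = i" for i
    using p by (simp add: bij_is_inj)
  have "T -` box l u = box l' u'"
  proof (intro set_eqI)
    fix x
    have "x \<in> box l' u' \<longleftrightarrow> (\<forall>i. l' $ p i < x $ p i \<and> x $ p i < u' $ p i)"
      using p by (simp add: mem_box_cart) (metis bij_pointE)
    also have "\<dots> \<longleftrightarrow> (\<forall>i. l $ i < s i * x $ p i \<and> s i * x $ p i < u $ i)"
    proof (intro all_cong1)
      fix i
      show "l' $ p i < x $ p i \<and> x $ p i < u' $ p i \<longleftrightarrow> l $ i < s i * x $ p i \<and> s i * x $ p i < u $ i"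
        using s[of i] by (auto simp: l'_def u'_def inv)
    qed
    finally show "x \<in> T -` box l u \<longleftrightarrow> x \<in> box l' u'"
      by (simp add: T_def mem_box_cart)
  qed
  then have "emeasure (distr lborel borel T) (box l u) = emeasure lborel (box l' u')"
    using T by (simp add: emeasure_distr)
  also have "\<dots> = ennreal (\<Prod>j\<in>UNIV. (u' - l') $ j)"
    unfolding prod_Basis_cart[symmetric]
    using le by (intro emeasure_lborel_box) (auto simp: Basis_vec_def inner_axis l'_def u'_def)
  also have "(\<Prod>j\<in>UNIV. (u' - l') $ j) = (\<Prod>i\<in>UNIV. (u' - l') $ p i)"
    using prod.reindex_bij_betw[OF p, of "\<lambda>j. (u' - l') $ j"] by simp
  also have "\<dots> = (\<Prod>i\<in>UNIV. (u - l) $ i)"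
    using s by (intro prod.cong) (auto simp: l'_def u'_def inv)
  finally show "emeasure (distr lborel borel (\<lambda>x :: real ^ 'd. \<chi> i. s i * x $ p i)) (box l u)
      = ennreal (\<Prod>b\<in>Basis. (u - l) \<bullet> b)"
    by (simp only: T_def prod_Basis_cart)
qed simp

lemma integral_unif_ball_isometry:
  fixes T :: "'a::euclidean_space \<Rightarrow> 'a" and f :: "'a \<Rightarrow> real"
  assumes T: "distr lborel borel T = lborel" "T \<in> borel_measurable borel" "\<And>x. norm (T x) = norm x"
    and f: "f \<in> borel_measurable borel"
  shows "(\<integral>x. f (T x) \<partial>(unif_ball r)) = (\<integral>x. f x \<partial>(unif_ball r))"
proof -
  have "distr (unif_ball r) borel T = unif_ball r"
  proof (rule measure_eqI)
    fix A
    assume "A \<in> sets (distr (unif_ball r) borel T)"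
    then have A: "A \<in> sets borel"
      by simp
    have vimage: "T -` A \<in> sets borel"
      using measurable_sets_borel[OF T(2) A] .
    have "emeasure (distr (unif_ball r) borel T) A
        = emeasure lborel (cball 0 r \<inter> T -` A) / emeasure lborel (cball (0::'a) r)"
      using T(2) A vimage by (simp add: emeasure_distr)
    also have "cball 0 r \<inter> T -` A = T -` (cball 0 r \<inter> A)"
      by (auto simp: T(3))
    also have "emeasure lborel \<dots> = emeasure (distr lborel borel T) (cball 0 r \<inter> A)"
      using T(2) A by (subst emeasure_distr) auto
    finally show "emeasure (distr (unif_ball r) borel T) A = emeasure (unif_ball r) A"
      using A by (simp add: T(1))
  qed simp
  moreover have "(\<integral>x. f (T x) \<partial>(unif_ball r)) = (\<integral>x. f x \<partial>(distr (unif_ball r) borel T))"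
    using T(2) f by (intro integral_distr[symmetric]) auto
  ultimately show ?thesis
    by simp
qed

lemma integral_unif_ball_signed_permutation:
  fixes f :: "real ^ 'd \<Rightarrow> real" and s :: "'d \<Rightarrow> real" and p :: "'d \<Rightarrow> 'd"
  assumes "\<And>i. s i = 1 \<or> s i = - 1" "bij p" "f \<in> borel_measurable borel"
  shows "(\<integral>x. f (\<chi> i. s i * x $ p i) \<partial>(unif_ball r)) = (\<integral>x. f x \<partial>(unif_ball r))"
proof (rule integral_unif_ball_isometry[where T = "\<lambda>x. \<chi> i. s i * x $ p i"])
  show "distr lborel borel (\<lambda>x :: real ^ 'd. \<chi> i. s i * x $ p i) = lborel"
    by (rule lborel_signed_permutation[OF assms(1,2)])
  show "(\<lambda>x :: real ^ 'd. \<chi> i. s i * x $ p i) \<in> borel_measurable borel"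
    by (intro borel_measurable_continuous_onI continuous_intros)
  fix x :: "real ^ 'd"
  have "(\<Sum>i\<in>UNIV. (s i * x $ p i)\<^sup>2) = (\<Sum>i\<in>UNIV. (x $ p i)\<^sup>2)"
    using assms(1) by (intro sum.cong) (auto simp: power_mult_distrib, metis power2_minus power_one)
  also have "\<dots> = (\<Sum>i\<in>UNIV. (x $ i)\<^sup>2)"
    using sum.reindex_bij_betw[OF assms(2), of "\<lambda>j. (x $ j)\<^sup>2"] by simp
  finally show "norm (\<chi> i. s i * x $ p i) = norm x"
    by (simp add: norm_vec_def L2_set_def)
qed (rule assms)

text \<open>Reflections kill the off-diagonal entries and transpositions equate the diagonal ones,
  whose sum is the integral of \<open>h (x \<bullet> x) * (x \<bullet> x)\<close>. Bounding
  \<open>h u * u\<close> suffices since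
  \<open>\<bar>x $ i * x $ j\<bar> \<le> x \<bullet> x\<close>.\<close>

lemma integral_unif_ball_components:
  fixes h :: "real \<Rightarrow> real" and i j :: "'d::finite"
  assumes r: "0 < r" and h: "h \<in> borel_measurable borel" and bound: "\<And>u. 0 \<le> u \<Longrightarrow> u \<le> r\<^sup>2 \<Longrightarrow> \<bar>h u * u\<bar> \<le> C"
  shows "integrable (unif_ball r) (\<lambda>x :: real ^ 'd. h (x \<bullet> x) * (x $ i * x $ j))"
    and "(\<integral>x. h (x \<bullet> x) * (x $ i * x $ j) \<partial>(unif_ball r :: (real ^ 'd) measure))
      = (if i = j then (\<integral>x. h (x \<bullet> x) * (x \<bullet> x) \<partial>(unif_ball r :: (real ^ 'd) measure)) / real CARD('d) else 0)"
proof -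
  define F where "F i j x = h (x \<bullet> x) * (x $ i * x $ j)" for i j and x :: "real ^ 'd"
  have F_meas: "F i j \<in> borel_measurable borel" for i j
    unfolding F_def using h by measurable
  have int: "integrable (unif_ball r) (F i j)" for i j
  proof (rule integrable_unif_ball[OF r F_meas])
    fix x :: "real ^ 'd"
    assume "norm x \<le> r"
    then have le: "x \<bullet> x \<le> r\<^sup>2"
      using power_mono[of "norm x" r 2] by (simp add: power2_norm_eq_inner)
    have "\<bar>x $ i\<bar> * \<bar>x $ j\<bar> \<le> norm x * norm x"
      by (intro mult_mono component_le_norm_cart) auto
    also have "\<dots> = x \<bullet> x"
      by (simp add: dot_square_norm power2_eq_square)
    finally have "\<bar>F i j x\<bar> \<le> \<bar>h (x \<bullet> x)\<bar> * (x \<bullet> x)"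
      by (simp add: F_def abs_mult mult_left_mono)
    also have "\<dots> \<le> C"
      using bound[OF _ le] by (simp add: abs_mult)
    finally show "\<bar>F i j x\<bar> \<le> C" .
  qed
  then show "integrable (unif_ball r) (\<lambda>x :: real ^ 'd. h (x \<bullet> x) * (x $ i * x $ j))"
    unfolding F_def .
  define I where "I i j = (\<integral>x. F i j x \<partial>(unif_ball r))" for i j
  have inner: "(\<chi> k. s k * x $ p k) \<bullet> (\<chi> k. s k * x $ p k) = x \<bullet> x"
    if "\<And>i. s i = 1 \<or> s i = - 1" "bij p"
    for s :: "'d \<Rightarrow> real" and p :: "'d \<Rightarrow> 'd" and x :: "real ^ 'd"
  proof -
    have "(\<chi> k. s k * x $ p k) \<bullet> (\<chi> k. s k * x $ p k) = (\<Sum>k\<in>UNIV. x $ p k * x $ p k)"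
      unfolding inner_vec_def
    proof (intro sum.cong refl)
      fix k
      show "(\<chi> k. s k * x $ p k) $ k \<bullet> (\<chi> k. s k * x $ p k) $ k = x $ p k * x $ p k"
        using that(1)[of k] by auto
    qed
    then show ?thesis
      using sum.reindex_bij_betw[OF that(2), of "\<lambda>j. x $ j * x $ j"] by (simp add: inner_vec_def)
  qed
  have sym: "I i j = s i * s j * I (p i) (p j)" if "\<And>i. s i = 1 \<or> s i = - 1" "bij p" for i j and s :: "'d \<Rightarrow> real" and p
  proof -
    have "I i j = (\<integral>x. F i j (\<chi> k. s k * x $ p k) \<partial>(unif_ball r))"
      unfolding I_def by (rule integral_unif_ball_signed_permutation[symmetric, OF that F_meas])
    also have "\<dots> = (\<integral>x. (s i * s j) * F (p i) (p j) x \<partial>(unif_ball r))"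
      by (intro Bochner_Integration.integral_cong) (simp_all add: F_def inner[OF that])
    finally show ?thesis
      by (simp add: I_def)
  qed
  \<comment> \<open>Flipping the sign of coordinate \<open>i\<close> alone gives
    \<open>I i j = - I i j\<close>.\<close>
  have off: "I i j = 0" if "i \<noteq> j" for i j
    using sym[of "\<lambda>k. if k = i then - 1 else 1" id i j] that by simp
  have diag: "I i i = I j j" for i j
    using sym[of "\<lambda>_. 1" "Transposition.transpose i j" i i] by simp
  have "(\<integral>x. h (x \<bullet> x) * (x \<bullet> x) \<partial>(unif_ball r :: (real ^ 'd) measure)) = (\<integral>x. (\<Sum>k\<in>UNIV. F k k x) \<partial>(unif_ball r))"
    by (simp add: F_def inner_vec_def sum_distrib_left)
  also have "\<dots> = (\<Sum>k\<in>(UNIV :: 'd set). I k k)"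
    unfolding I_def by (intro Bochner_Integration.integral_sum int)
  also have "\<dots> = (\<Sum>k\<in>(UNIV :: 'd set). I i i)"
    by (intro sum.cong refl diag)
  also have "\<dots> = real CARD('d) * I i i"
    by simp
  finally have "I i i = (\<integral>x. h (x \<bullet> x) * (x \<bullet> x) \<partial>(unif_ball r :: (real ^ 'd) measure)) / real CARD('d)"
    by simp
  with off[of i j] show "(\<integral>x. h (x \<bullet> x) * (x $ i * x $ j) \<partial>(unif_ball r :: (real ^ 'd) measure))
      = (if i = j then (\<integral>x. h (x \<bullet> x) * (x \<bullet> x) \<partial>(unif_ball r :: (real ^ 'd) measure)) / real CARD('d) else 0)"
    by (auto simp: I_def F_def)
qed

section \<open>The Bernstein estimate for one summand\<close>

text \<open>Every further factor is at least 3. This is where the 3 in the Bernstein denominator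
  originates.\<close>

lemma fact_ge_2_3_power: "2 * 3 ^ k \<le> (fact (k + 2) :: real)"
proof (induction k)
  case (Suc k)
  have "2 * 3 ^ Suc k = 3 * (2 * 3 ^ k :: real)"
    by simp
  also have "\<dots> \<le> (real k + 3) * fact (k + 2)"
    using Suc by (intro mult_mono) auto
  finally show ?case
    by (simp add: algebra_simps)
qed (simp add: fact_numeral)

text \<open>The Taylor remainder after the linear term is dominated termwise by a geometric series
  of ratio \<open>q / 3\<close>.\<close>

lemma exp_le_quadratic:
  fixes y q :: real
  assumes "\<bar>y\<bar> \<le> q" "q < 3"
  shows "exp y \<le> 1 + y + y\<^sup>2 / 2 / (1 - q / 3)"
proof -
  have q: "0 \<le> q"
    using assms by linarith
  have exp: "(\<lambda>n. y ^ (n + 2) / fact (n + 2)) sums (exp y - (1 + y))"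
    using sums_split_initial_segment[OF exp_converges[of y], of 2]
    by (simp add: divide_inverse mult.commute numeral_2_eq_2)
  have geom: "(\<lambda>n. y\<^sup>2 / 2 * (q / 3) ^ n) sums (y\<^sup>2 / 2 * (1 / (1 - q / 3)))"
    using assms q by (intro sums_mult geometric_sums) simp
  have "exp y - (1 + y) \<le> y\<^sup>2 / 2 * (1 / (1 - q / 3))"
  proof (rule sums_le[OF _ exp geom])
    fix n
    have "y ^ n \<le> \<bar>y\<bar> ^ n"
      by (metis abs_ge_self power_abs)
    then have "y ^ (n + 2) \<le> y\<^sup>2 * \<bar>y\<bar> ^ n"
      unfolding power_add mult.commute[of "y ^ n"] by (rule mult_left_mono) simp
    then have "y ^ (n + 2) / fact (n + 2) \<le> (y\<^sup>2 * \<bar>y\<bar> ^ n) / fact (n + 2)"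
      by (rule divide_right_mono) simp
    also have "\<dots> \<le> (y\<^sup>2 * q ^ n) / fact (n + 2)"
      using assms by (intro divide_right_mono mult_left_mono power_mono) auto
    also have "\<dots> \<le> (y\<^sup>2 * q ^ n) / (2 * 3 ^ n)"
      using q by (intro divide_left_mono fact_ge_2_3_power) auto
    finally show "y ^ (n + 2) / fact (n + 2) \<le> y\<^sup>2 / 2 * (q / 3) ^ n"
      by (simp add: power_divide)
  qed
  then show ?thesis
    by simp
qed

text \<open>By symmetry the mean of the matrix exponential is a multiple of the identity, so pairing
  it with a fixed \<open>A\<close> leaves \<open>tr A\<close> times a scalar.\<close>

lemma integral_tr_mult_exp_outer:
  fixes A :: "'d::finite sqmat"
  assumes r: "0 < r"
  shows "integrable (unif_ball r) (\<lambda>x. tr (A * exp (t *\<^sub>R (outer x - s *\<^sub>R 1))))"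
    and "(\<integral>x. tr (A * exp (t *\<^sub>R (outer x - s *\<^sub>R 1))) \<partial>(unif_ball r))
      = tr A * (\<integral>x. exp (- t * s) * (1 + (exp (t * (x \<bullet> x)) - 1) / real CARD('d)) \<partial>(unif_ball r :: (real ^ 'd) measure))"
proof -
  interpret prob_space "unif_ball r :: (real ^ 'd) measure"
    by (rule prob_space_unif_ball[OF r])
  \<comment> \<open>At \<open>u = 0\<close> the quotient is 0, and
    \<open>h u * u = exp (t * u) - 1\<close> still holds there.\<close>
  define h where "h u = (exp (t * u) - 1) / u" for u
  have h_meas: "h \<in> borel_measurable borel"
    unfolding h_def by measurable
  have hu: "h u * u = exp (t * u) - 1" for u
    by (simp add: h_def)
  have bound: "\<bar>h u * u\<bar> \<le> exp (\<bar>t\<bar> * r\<^sup>2) + 1" if "0 \<le> u" "u \<le> r\<^sup>2" for u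
  proof -
    have "t * u \<le> \<bar>t\<bar> * r\<^sup>2"
      using that by (intro mult_mono) auto
    then have "exp (t * u) \<le> exp (\<bar>t\<bar> * r\<^sup>2)"
      by simp
    then show ?thesis
      using exp_gt_zero[of "t * u"] unfolding hu by linarith
  qed
  note comp = integral_unif_ball_components[where 'd = 'd, OF r h_meas bound]
  have expand: "tr (A * exp (t *\<^sub>R (outer x - s *\<^sub>R 1)))
      = exp (- t * s) * (tr A + (\<Sum>i\<in>UNIV. \<Sum>j\<in>UNIV. mat_of A $ i $ j * (h (x \<bullet> x) * (x $ i * x $ j))))" for x
    by (simp add: exp_scaleR_outer_diff distrib_left tr_add tr_scaleR tr_mult_outer sum_distrib_left
        mult_ac flip: h_def)
  show "integrable (unif_ball r) (\<lambda>x. tr (A * exp (t *\<^sub>R (outer x - s *\<^sub>R 1))))"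
    unfolding expand using comp(1) 
    by (intro integrable_mult_right Bochner_Integration.integrable_add Bochner_Integration.integrable_sum
        integrable_const)
  let ?I = "\<integral>x. h (x \<bullet> x) * (x \<bullet> x) \<partial>(unif_ball r :: (real ^ 'd) measure)"
  have int_h: "integrable (unif_ball r :: (real ^ 'd) measure) (\<lambda>x. h (x \<bullet> x) * (x \<bullet> x))"
    using Bochner_Integration.integrable_sum[of UNIV "unif_ball r", OF comp(1)[of i i for i]]
    by (simp add: inner_vec_def sum_distrib_left)
  have "(\<integral>x. tr (A * exp (t *\<^sub>R (outer x - s *\<^sub>R 1))) \<partial>(unif_ball r))
      = exp (- t * s) * (tr A + (\<Sum>i\<in>UNIV. \<Sum>j\<in>UNIV. mat_of A $ i $ j * (if i = j then ?I / real CARD('d) else 0)))"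
    unfolding expand using comp prob_space by simp
  also have "(\<Sum>i\<in>UNIV. \<Sum>j\<in>UNIV. mat_of A $ i $ j * (if i = j then ?I / real CARD('d) else 0))
      = tr A * (?I / real CARD('d))"
    by (simp add: tr.rep_eq trace_def sum_distrib_right sum_divide_distrib if_distrib[of "\<lambda>c. _ * c"] cong: if_cong)
  also have "exp (- t * s) * (tr A + tr A * (?I / real CARD('d))) = tr A * (exp (- t * s) * (1 + ?I / real CARD('d)))"
    by (simp add: algebra_simps)
  also have "exp (- t * s) * (1 + ?I / real CARD('d))
      = (\<integral>x. exp (- t * s) * (1 + h (x \<bullet> x) * (x \<bullet> x) / real CARD('d)) \<partial>(unif_ball r :: (real ^ 'd) measure))"
    using int_h prob_space by simp
  finally show "(\<integral>x. tr (A * exp (t *\<^sub>R (outer x - s *\<^sub>R 1))) \<partial>(unif_ball r))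
      = tr A * (\<integral>x. exp (- t * s) * (1 + (exp (t * (x \<bullet> x)) - 1) / real CARD('d)) \<partial>(unif_ball r :: (real ^ 'd) measure))"
    by (simp only: hu)
qed

text \<open>The summands have mean zero because \<open>\<parallel>x\<parallel>\<^sup>2\<close> has mean \<open>d s\<close>, and the variance bound
  \<open>(d + 1) s\<^sup>2\<close> only uses \<open>\<parallel>x\<parallel>\<^sup>4 \<le> (d + 2) s \<parallel>x\<parallel>\<^sup>2\<close>.\<close>

lemma integral_exp_unif_ball_le:
  fixes s t :: real
  defines "d \<equiv> real CARD('d::finite)"
  assumes s: "0 < s" and t: "\<bar>t\<bar> * ((d + 1) * s) < 3"
  shows "(\<integral>x. exp (- t * s) * (1 + (exp (t * (x \<bullet> x)) - 1) / d) \<partial>(unif_ball (sqrt ((d + 2) * s)) :: (real ^ 'd) measure))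
    \<le> exp (t\<^sup>2 / 2 / (1 - \<bar>t\<bar> * ((d + 1) * s) / 3) * ((d + 1) * s\<^sup>2))"
proof -
  define r where "r = sqrt ((d + 2) * s)"
  define K where "K = t\<^sup>2 / 2 / (1 - \<bar>t\<bar> * ((d + 1) * s) / 3)"
  have d: "1 \<le> d"
    unfolding d_def by (simp add: Suc_leI)
  have r: "0 < r" and r2: "r\<^sup>2 = (d + 2) * s"
    using d s by (simp_all add: r_def)
  interpret prob_space "unif_ball r :: (real ^ 'd) measure"
    by (rule prob_space_unif_ball[OF r])
  have K: "0 \<le> K"
    unfolding K_def using t by (intro divide_nonneg_nonneg) simp_all
  have quad: "exp (t * v) \<le> 1 + t * v + K * v\<^sup>2" if "\<bar>v\<bar> \<le> (d + 1) * s" for v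
  proof -
    have "\<bar>t * v\<bar> \<le> \<bar>t\<bar> * ((d + 1) * s)"
      using that by (simp add: abs_mult mult_left_mono)
    from exp_le_quadratic[OF this t] show ?thesis
      by (simp add: K_def power_mult_distrib)
  qed
  have pointwise: "exp (- t * s) * (1 + (exp (t * u) - 1) / d) \<le> 1 + t * (u / d - s) + K / d * (d * s\<^sup>2 + d * s * u)"
    if u: "0 \<le> u" "u \<le> (d + 2) * s" for u
  proof -
    have 1: "exp (- t * s) \<le> 1 - t * s + K * s\<^sup>2"
      using quad[of "- s"] d s by simp
    have 2: "exp (t * (u - s)) \<le> 1 + t * (u - s) + K * (u - s)\<^sup>2"
      using u d s by (intro quad) (auto simp: abs_le_iff algebra_simps)
    \<comment> \<open>This is the normalised trace of the exponential: the summand has eigenvalue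
      \<open>- s\<close> with multiplicity \<open>d - 1\<close> and \<open>u - s\<close>
      once.\<close>
    have "exp (- t * s) * (1 + (exp (t * u) - 1) / d) = ((d - 1) * exp (- t * s) + exp (t * (u - s))) / d"
      using d by (simp add: field_simps exp_diff exp_minus)
    also have "\<dots> \<le> ((d - 1) * (1 - t * s + K * s\<^sup>2) + (1 + t * (u - s) + K * (u - s)\<^sup>2)) / d"
      using d by (intro divide_right_mono add_mono mult_left_mono 1 2) auto
    also have "\<dots> = 1 + t * (u / d - s) + K / d * (d * s\<^sup>2 + u * u - 2 * u * s)"
      using d by (simp add: field_simps power2_eq_square)
    \<comment> \<open>Since \<open>u * u \<le> (d + 2) * s * u\<close>, the bound becomes affine in
      \<open>u\<close>, so that the mean alone determines its integral.\<close>
    also have "\<dots> \<le> 1 + t * (u / d - s) + K / d * (d * s\<^sup>2 + d * s * u)"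
      using d K u by (intro add_left_mono mult_left_mono)
        (use mult_right_mono[OF u(2) u(1)] in \<open>auto simp: algebra_simps\<close>)
    finally show ?thesis .
  qed
  have int_u: "integrable (unif_ball r :: (real ^ 'd) measure) (\<lambda>x. x \<bullet> x)"
    by (rule integrable_unif_ball[OF r, where C = "r\<^sup>2"]) (auto simp: dot_square_norm power_mono)
  have mean: "(\<integral>x. x \<bullet> x \<partial>(unif_ball r :: (real ^ 'd) measure)) = d * s"
    using integral_unif_ball_inner_self[OF r, where 'a = "real ^ 'd"] d by (simp add: r2 d_def)
  let ?bound = "\<lambda>x :: real ^ 'd. 1 + t * ((x \<bullet> x) / d - s) + K / d * (d * s\<^sup>2 + d * s * (x \<bullet> x))"
  have "(\<integral>x. exp (- t * s) * (1 + (exp (t * (x \<bullet> x)) - 1) / d) \<partial>(unif_ball r :: (real ^ 'd) measure))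
      \<le> (\<integral>x. ?bound x \<partial>(unif_ball r))"
  proof (rule integral_mono_AE')
    show "integrable (unif_ball r) ?bound"
      using int_u by simp
    have *: "exp (- t * s) * (1 + (exp (t * (x \<bullet> x)) - 1) / d) \<le> ?bound x" if "norm x \<le> r" for x :: "real ^ 'd"
      using that r2 power_mono[OF that, of 2] by (intro pointwise) (auto simp: dot_square_norm)
    show "AE x in (unif_ball r :: (real ^ 'd) measure). exp (- t * s) * (1 + (exp (t * (x \<bullet> x)) - 1) / d) \<le> ?bound x"
      using AE_unif_ball[OF r] by eventually_elim (rule *)
    \<comment> \<open>The integrand is nonnegative because \<open>d \<ge> 1\<close>, so its majorant
      is nonnegative on the ball as well.\<close>
    have "0 \<le> exp (- t * s) * (1 + (exp (t * u) - 1) / d)" for u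
    proof -
      have "- 1 / d \<le> (exp (t * u) - 1) / d"
        using d by (intro divide_right_mono) auto
      moreover have "- 1 \<le> - 1 / d"
        using d by (simp add: divide_simps)
      ultimately show ?thesis
        by simp
    qed
    then have *: "0 \<le> ?bound x" if "norm x \<le> r" for x :: "real ^ 'd"
      using *[OF that] order_trans by blast
    show "AE x in (unif_ball r :: (real ^ 'd) measure). 0 \<le> ?bound x"
      using AE_unif_ball[OF r] by eventually_elim (rule *)
  qed
  \<comment> \<open>Inserting the mean \<open>d * s\<close> cancels the term linear in
    \<open>t\<close>.\<close>
  also have "\<dots> = 1 + t * (d * s / d - s) + K / d * (d * s\<^sup>2 + d * s * (d * s))"
    using int_u mean prob_space by simp
  also have "\<dots> = 1 + K * ((d + 1) * s\<^sup>2)"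
    using d by (simp add: field_simps power2_eq_square)
  also have "\<dots> \<le> exp (K * ((d + 1) * s\<^sup>2))"
    by (rule exp_ge_add_one_self)
  finally show ?thesis
    by (simp only: K_def r_def)
qed

section \<open>The tail bound\<close>

lemma borel_measurable_tr_exp: "(\<lambda>A. tr (exp (sq_of A))) \<in> borel_measurable borel"
proof -
  have sums: "(\<lambda>n. tr (sq_of A ^ n /\<^sub>R fact n)) sums tr (exp (sq_of A))" for A :: "real ^ 'd ^ 'd"
    by (rule bounded_linear.sums[OF bounded_linear_tr exp_converges])
  have eq: "(\<lambda>A :: real ^ 'd ^ 'd. tr (exp (sq_of A))) = (\<lambda>A. \<Sum>n. tr (sq_of A ^ n /\<^sub>R fact n))"
    by (rule ext) (rule sums_unique[OF sums])
  have "continuous_on UNIV (\<lambda>A :: real ^ 'd ^ 'd. tr (sq_of A ^ n /\<^sub>R fact n))" for n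
    by (intro bounded_linear.continuous_on[OF bounded_linear_tr] continuous_intros
        bounded_linear.continuous_on[OF bounded_linear_sq_of])
  then show ?thesis
    unfolding eq by (intro borel_measurable_suminf borel_measurable_continuous_onI)
qed

text \<open>For \<open>s = 1 / n\<close> and \<open>I = {1..n}\<close> this is S - I_d. Keeping
  \<open>s\<close> independent of \<open>I\<close> allows induction over the index set.\<close>

definition deviation :: "real \<Rightarrow> 'i set \<Rightarrow> ('i \<Rightarrow> real ^ 'd) \<Rightarrow> 'd::finite sqmat" where
  "deviation s I x = (\<Sum>i\<in>I. outer (x i) - s *\<^sub>R 1)"

lemma adj_deviation [simp]: "adj (deviation s I x) = deviation s I x"
  unfolding deviation_def linear_sum[OF bounded_linear.linear[OF bounded_linear_adj]]
  by (simp add: linear_diff[OF bounded_linear.linear[OF bounded_linear_adj]] adj_scaleR)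

lemma mat_of_deviation: "mat_of (deviation s I x) = (\<Sum>i\<in>I. (\<chi> j k. x i $ j * x i $ k) - s *\<^sub>R mat 1)"
  unfolding deviation_def linear_sum[OF bounded_linear.linear[OF bounded_linear_mat_of]]
  by (simp add: minus_sqmat.rep_eq scaleR_sqmat.rep_eq one_sqmat.rep_eq mat_of_outer)

text \<open>The sum is treated in the Euclidean matrix type, where Borel measurability passes to
  sums; each summand is continuous in one coordinate of the product.\<close>

lemma measurable_mat_of_deviation [measurable]:
  "(\<lambda>x. mat_of (deviation s I x)) \<in> borel_measurable (\<Pi>\<^sub>M i\<in>I. borel)"
proof -
  have "(\<lambda>v :: real ^ 'd. (\<chi> j k. v $ j * v $ k) :: real ^ 'd ^ 'd) \<in> borel_measurable borel"
    by (intro borel_measurable_continuous_onI continuous_intros)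
  then have "(\<lambda>x. (\<chi> j k. x i $ j * x i $ k) :: real ^ 'd ^ 'd) \<in> borel_measurable (\<Pi>\<^sub>M i\<in>I. borel)"
    if "i \<in> I" for i
    by (rule measurable_compose[OF measurable_component_singleton[OF that]])
  then show ?thesis
    unfolding mat_of_deviation by (intro borel_measurable_sum borel_measurable_diff) auto
qed

lemma measurable_tr_exp_deviation:
  "(\<lambda>x. tr (exp (t *\<^sub>R deviation s I x))) \<in> borel_measurable (\<Pi>\<^sub>M i\<in>I. borel)"
proof -
  have "(\<lambda>x. tr (exp (sq_of (t *\<^sub>R mat_of (deviation s I x))))) \<in> borel_measurable (\<Pi>\<^sub>M i\<in>I. borel)"
    by (rule measurable_compose[OF _ borel_measurable_tr_exp]) measurable
  then show ?thesis
    by (simp add: mat_of_inverse flip: scaleR_sqmat.rep_eq)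
qed

lemma measurable_norm_deviation:
  "(\<lambda>x. norm (deviation s I x)) \<in> borel_measurable (\<Pi>\<^sub>M i\<in>I. borel)"
proof -
  have "continuous_on UNIV (\<lambda>A :: real ^ 'd ^ 'd. norm (sq_of A))"
    by (intro continuous_on_norm bounded_linear.continuous_on[OF bounded_linear_sq_of] continuous_on_id)
  then have "(\<lambda>A :: real ^ 'd ^ 'd. norm (sq_of A)) \<in> borel_measurable borel"
    by (rule borel_measurable_continuous_onI)
  from measurable_compose[OF measurable_mat_of_deviation this] show ?thesis
    by (simp add: mat_of_inverse)
qed

text \<open>The expectation of the exponential of one summand is a scalar matrix by the symmetry of the
  ball; this is why Golden--Thompson suffices in place of Lieb's concavity theorem.\<close>

lemma nn_integral_tr_exp_deviation_le:
  fixes s t :: real and I :: "'i set"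
  defines "d \<equiv> real CARD('d::finite)"
  assumes s: "0 < s" and t: "\<bar>t\<bar> * ((d + 1) * s) < 3" and "finite I"
  shows "(\<integral>\<^sup>+x. ennreal (tr (exp (t *\<^sub>R deviation s I x))) \<partial>(\<Pi>\<^sub>M i\<in>I. (unif_ball (sqrt ((d + 2) * s)) :: (real ^ 'd) measure)))
    \<le> ennreal (d * exp (t\<^sup>2 / 2 / (1 - \<bar>t\<bar> * ((d + 1) * s) / 3) * ((d + 1) * s\<^sup>2)) ^ card I)"
proof -
  define r where "r = sqrt ((d + 2) * s)"
  define \<phi> where "\<phi> = exp (t\<^sup>2 / 2 / (1 - \<bar>t\<bar> * ((d + 1) * s) / 3) * ((d + 1) * s\<^sup>2))"
  define U where "U = (unif_ball r :: (real ^ 'd) measure)"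
  have sets_U [measurable_cong]: "sets U = sets borel"
    by (simp add: U_def)
  have r: "0 < r"
    using s by (simp add: r_def d_def)
  interpret prob_space U
    unfolding U_def by (rule prob_space_unif_ball[OF r])
  interpret product_sigma_finite "\<lambda>_ :: 'i. U"
    by unfold_locales
  have adj: "adj (t *\<^sub>R deviation s J x) = t *\<^sub>R deviation s J x" for J and x :: "'i \<Rightarrow> real ^ 'd"
    by (simp add: adj_scaleR)
  have meas: "(\<lambda>x. ennreal (tr (exp (t *\<^sub>R deviation s J x)))) \<in> borel_measurable (\<Pi>\<^sub>M i\<in>J. U)" for J :: "'i set"
  proof -
    have "sets (\<Pi>\<^sub>M i\<in>J. U) = sets (\<Pi>\<^sub>M i\<in>J. borel)"
      by (intro sets_PiM_cong refl sets_U)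
    from measurable_cong_sets[OF this refl] show ?thesis
      using measurable_compose[OF measurable_tr_exp_deviation[of t s J] measurable_ennreal] by blast
  qed
  have step: "(\<integral>\<^sup>+y. ennreal (tr (exp (t *\<^sub>R deviation s (insert i J) (x(i := y))))) \<partial>U)
      \<le> ennreal (tr (exp (t *\<^sub>R deviation s J x))) * ennreal \<phi>"
    if J: "finite J" "i \<notin> J" for i J and x :: "'i \<Rightarrow> real ^ 'd"
  proof -
    let ?A = "t *\<^sub>R deviation s J x"
    let ?X = "\<lambda>y. t *\<^sub>R (outer y - s *\<^sub>R 1) :: 'd sqmat"
    have split: "t *\<^sub>R deviation s (insert i J) (x(i := y)) = ?A + ?X y" for y
    proof -
      have "(\<Sum>j\<in>J. outer ((x(i := y)) j) - s *\<^sub>R 1) = (\<Sum>j\<in>J. outer (x j) - s *\<^sub>R 1)"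
        using J by (intro sum.cong) auto
      then show ?thesis
        using J by (simp add: deviation_def scaleR_add_right add.commute)
    qed
    have GT: "tr (exp (?A + ?X y)) \<le> tr (exp ?A * exp (?X y))" for y
      using adj_deviation[of s "{()}" "\<lambda>_. y"]
      by (intro Golden_Thompson adj) (simp add: adj_scaleR deviation_def)
    \<comment> \<open>A product of two exponentials need not be self-adjoint; its trace is
      nonnegative because it dominates that of a single exponential.\<close>
    have nonneg: "0 \<le> tr (exp ?A * exp (?X y))" for y
    proof -
      have "0 \<le> tr (exp (?A + ?X y))"
        using adj[of "insert i J" "x(i := y)"] unfolding split by (rule tr_exp_nonneg)
      then show ?thesis
        using GT order_trans by blast
    qed
    have "(\<integral>\<^sup>+y. ennreal (tr (exp (t *\<^sub>R deviation s (insert i J) (x(i := y))))) \<partial>U)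
        \<le> (\<integral>\<^sup>+y. ennreal (tr (exp ?A * exp (?X y))) \<partial>U)"
      unfolding split by (intro nn_integral_mono ennreal_leI GT)
    also have "\<dots> = ennreal (\<integral>y. tr (exp ?A * exp (?X y)) \<partial>U)"
      using nonneg integral_tr_mult_exp_outer(1)[OF r] unfolding U_def
      by (intro nn_integral_eq_integral) auto
    also have "(\<integral>y. tr (exp ?A * exp (?X y)) \<partial>U)
        = tr (exp ?A) * (\<integral>y. exp (- t * s) * (1 + (exp (t * (y \<bullet> y)) - 1) / d) \<partial>U)"
      unfolding U_def d_def by (rule integral_tr_mult_exp_outer(2)[OF r])
    also have "ennreal \<dots> \<le> ennreal (tr (exp ?A) * \<phi>)"
      using integral_exp_unif_ball_le[where 'd = 'd, OF s] t
      by (intro ennreal_leI mult_left_mono tr_exp_nonneg adj) (simp add: U_def r_def \<phi>_def d_def)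
    also have "\<dots> = ennreal (tr (exp ?A)) * ennreal \<phi>"
      by (intro ennreal_mult tr_exp_nonneg adj) (simp add: \<phi>_def)
    finally show ?thesis .
  qed
  have "(\<integral>\<^sup>+x. ennreal (tr (exp (t *\<^sub>R deviation s I x))) \<partial>(\<Pi>\<^sub>M i\<in>I. U)) \<le> ennreal (d * \<phi> ^ card I)"
    using \<open>finite I\<close>
  proof (induction I)
    \<comment> \<open>The empty sum leaves the trace of the identity, which is the dimensional
      factor \<open>d\<close>.\<close>
    case empty
    then show ?case
      by (simp add: PiM_empty nn_integral_count_space_finite deviation_def d_def)
  next
    case (insert i J)
    have "(\<integral>\<^sup>+x. ennreal (tr (exp (t *\<^sub>R deviation s (insert i J) x))) \<partial>(\<Pi>\<^sub>M i\<in>insert i J. U))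
        = (\<integral>\<^sup>+x. (\<integral>\<^sup>+y. ennreal (tr (exp (t *\<^sub>R deviation s (insert i J) (x(i := y))))) \<partial>U) \<partial>(\<Pi>\<^sub>M i\<in>J. U))"
      using insert.hyps by (intro product_nn_integral_insert meas)
    also have "\<dots> \<le> (\<integral>\<^sup>+x. ennreal (tr (exp (t *\<^sub>R deviation s J x))) * ennreal \<phi> \<partial>(\<Pi>\<^sub>M i\<in>J. U))"
      by (intro nn_integral_mono step insert.hyps)
    also have "\<dots> = (\<integral>\<^sup>+x. ennreal (tr (exp (t *\<^sub>R deviation s J x))) \<partial>(\<Pi>\<^sub>M i\<in>J. U)) * ennreal \<phi>"
      by (intro nn_integral_multc meas)
    also have "\<dots> \<le> ennreal (d * \<phi> ^ card J) * ennreal \<phi>"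
      by (intro mult_right_mono insert.IH) simp
    also have "\<dots> = ennreal (d * \<phi> ^ card (insert i J))"
      using insert.hyps by (subst ennreal_mult[symmetric]) (auto simp: d_def \<phi>_def mult_ac)
    finally show ?case .
  qed
  then show ?thesis
    by (simp only: U_def r_def \<phi>_def)
qed

text \<open>Markov's inequality for the exponential moment, with an explicit
  \<open>\<theta>\<close>. Measurability of \<open>E\<close> is part of the conclusion because the
  Frobenius event is later enclosed in such a set.\<close>

lemma tail_norm_deviation:
  fixes M :: "'a measure" and x :: "nat \<Rightarrow> 'a \<Rightarrow> real ^ 'd" and n :: nat and \<delta> :: real
  defines "d \<equiv> real CARD('d)"
  assumes "prob_space M"
    and n: "n \<ge> 1"
    and indep: "prob_space.indep_vars M (\<lambda>_. borel) x {1..n}"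
    and unif: "\<And>i. i \<in> {1..n} \<Longrightarrow> distr M borel (x i) = unif_ball (sqrt ((d + 2) / real n))"
    and \<delta>: "\<delta> \<ge> 0"
  defines "E \<equiv> {\<omega> \<in> space M. \<delta> \<le> norm (deviation (1 / real n) {1..n} (\<lambda>i. x i \<omega>))}"
  shows "E \<in> sets M"
    and "measure M E \<le> 2 * d * exp (- (real n * \<delta>\<^sup>2 / (2 * d + 2 + 2 * \<delta> * (d + 1) / 3)))"
proof -
  interpret prob_space M by fact
  define s where "s = 1 / real n"
  \<comment> \<open>\<open>L\<close> plays both Bernstein roles: it bounds the norm of a summand
    and, as \<open>real n * s = 1\<close>, also the total variance.\<close>
  define L where "L = (d + 1) * s"
  \<comment> \<open>The usual Bernstein choice: deviation over variance plus
    \<open>L * \<delta> / 3\<close>.\<close>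
  define \<theta> where "\<theta> = \<delta> / (L * (1 + \<delta> / 3))"
  let ?J = "{1..n}"
  let ?U = "unif_ball (sqrt ((d + 2) * s)) :: (real ^ 'd) measure"
  \<comment> \<open>The product space consists of extensional functions, hence the restriction;
    \<open>deviation\<close> reads only the indices in \<open>?J\<close>.\<close>
  let ?X = "\<lambda>\<omega>. \<lambda>i\<in>?J. x i \<omega>"
  let ?Y = "\<lambda>\<omega>. deviation s ?J (\<lambda>i. x i \<omega>)"
  have s: "0 < s" and d: "0 < d" and L: "0 < L"
    using n by (simp_all add: s_def L_def d_def add_pos_pos)
  have rv: "random_variable borel (x i)" if "i \<in> ?J" for i
    using indep that by (auto simp: indep_vars_def)
  have X: "?X \<in> measurable M (\<Pi>\<^sub>M i\<in>?J. borel)"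
    by (intro measurable_restrict rv)
  have restrict: "deviation s ?J (?X \<omega>) = ?Y \<omega>" for \<omega>
    by (simp add: deviation_def)
  have "(\<lambda>\<omega>. norm (deviation s ?J (?X \<omega>))) \<in> borel_measurable M"
    by (rule measurable_compose[OF X measurable_norm_deviation])
  then have "(\<lambda>\<omega>. norm (?Y \<omega>)) \<in> borel_measurable M"
    by (simp only: restrict)
  then show E: "E \<in> sets M"
    unfolding E_def s_def[symmetric] by measurable
  have "distr M (\<Pi>\<^sub>M i\<in>?J. borel) ?X = (\<Pi>\<^sub>M i\<in>?J. distr M borel (x i))"
    using indep n rv by (subst indep_vars_iff_distr_eq_PiM'[symmetric]) auto
  also have "\<dots> = (\<Pi>\<^sub>M i\<in>?J. ?U)"
    by (intro PiM_cong refl) (simp add: unif s_def)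
  finally have distr: "distr M (\<Pi>\<^sub>M i\<in>?J. borel) ?X = (\<Pi>\<^sub>M i\<in>?J. ?U)" .
  have \<theta>: "0 \<le> \<theta>" and \<theta>L: "\<theta> * L = \<delta> / (1 + \<delta> / 3)"
    using \<delta> L by (simp_all add: \<theta>_def)
  have less: "\<theta> * L < 3"
    unfolding \<theta>L using \<delta> by (simp add: divide_simps)
  define B where "B = d * exp (\<theta>\<^sup>2 / 2 / (1 - \<theta> * L / 3) * ((d + 1) * s\<^sup>2)) ^ n"
  have expectation: "(\<integral>\<^sup>+\<omega>. ennreal (tr (exp (t *\<^sub>R ?Y \<omega>))) \<partial>M) \<le> ennreal B" if t: "\<bar>t\<bar> = \<theta>" for t
  proof -
    have "(\<integral>\<^sup>+\<omega>. ennreal (tr (exp (t *\<^sub>R ?Y \<omega>))) \<partial>M)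
        = (\<integral>\<^sup>+y. ennreal (tr (exp (t *\<^sub>R deviation s ?J y))) \<partial>(distr M (\<Pi>\<^sub>M i\<in>?J. borel) ?X))"
      using measurable_compose[OF measurable_tr_exp_deviation[of t s ?J] measurable_ennreal]
      by (subst nn_integral_distr[OF X]) (simp_all only: restrict measurable_distr_eq1)
    also have "\<dots> \<le> ennreal (d * exp (t\<^sup>2 / 2 / (1 - \<bar>t\<bar> * ((d + 1) * s) / 3) * ((d + 1) * s\<^sup>2)) ^ card ?J)"
      unfolding distr d_def using s less t
      by (intro nn_integral_tr_exp_deviation_le) (simp_all add: L_def d_def)
    finally show ?thesis
      using t by (auto simp: B_def L_def)
  qed
  have adj: "adj (t *\<^sub>R ?Y \<omega>) = t *\<^sub>R ?Y \<omega>" for t \<omega>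
    by (simp add: adj_scaleR)
  have meas: "(\<lambda>\<omega>. ennreal (tr (exp (t *\<^sub>R ?Y \<omega>)))) \<in> borel_measurable M" for t
    using measurable_compose[OF X measurable_compose[OF measurable_tr_exp_deviation[of t s ?J] measurable_ennreal]]
    by (simp only: restrict)
  have "ennreal (exp (\<theta> * \<delta>)) * emeasure M E = (\<integral>\<^sup>+\<omega>. ennreal (exp (\<theta> * \<delta>)) * indicator E \<omega> \<partial>M)"
    using E by (simp add: nn_integral_cmult_indicator)
  also have "\<dots> \<le> (\<integral>\<^sup>+\<omega>. ennreal (tr (exp (\<theta> *\<^sub>R ?Y \<omega>))) + ennreal (tr (exp ((- \<theta>) *\<^sub>R ?Y \<omega>))) \<partial>M)"
  proof (intro nn_integral_mono)
    fix \<omega>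
    have "exp (\<theta> * \<delta>) \<le> tr (exp (\<theta> *\<^sub>R ?Y \<omega>)) + tr (exp ((- \<theta>) *\<^sub>R ?Y \<omega>))" if "\<delta> \<le> norm (?Y \<omega>)"
    proof -
      have "exp (\<theta> * \<delta>) \<le> exp (\<theta> * norm (?Y \<omega>))"
        using that \<theta> by (simp add: mult_left_mono)
      also have "\<dots> \<le> tr (exp (\<theta> *\<^sub>R ?Y \<omega>)) + tr (exp ((- \<theta>) *\<^sub>R ?Y \<omega>))"
        by (intro exp_norm_le_tr_exp adj_deviation \<theta>)
      finally show ?thesis .
    qed
    then show "ennreal (exp (\<theta> * \<delta>)) * indicator E \<omega>
        \<le> ennreal (tr (exp (\<theta> *\<^sub>R ?Y \<omega>))) + ennreal (tr (exp ((- \<theta>) *\<^sub>R ?Y \<omega>)))"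
      using tr_exp_nonneg[OF adj, of \<theta> \<omega>] tr_exp_nonneg[OF adj, of "- \<theta>" \<omega>]
      by (auto simp: E_def indicator_def s_def[symmetric] ennreal_plus[symmetric] simp del: ennreal_plus scaleR_minus_left intro!: ennreal_leI)
  qed
  also have "\<dots> \<le> ennreal B + ennreal B"
    using \<theta> by (subst nn_integral_add[OF meas meas]) (intro add_mono expectation; simp)
  also have "\<dots> = ennreal (2 * B)"
    using d by (simp add: B_def flip: ennreal_plus)
  finally have "ennreal (exp (\<theta> * \<delta>) * measure M E) \<le> ennreal (2 * B)"
    by (simp add: emeasure_eq_measure ennreal_mult)
  then have "exp (\<theta> * \<delta>) * measure M E \<le> 2 * B"
    using d by (subst (asm) ennreal_le_iff) (auto simp: B_def)
  then have "measure M E \<le> 2 * B * exp (- (\<theta> * \<delta>))"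
    by (simp add: exp_minus field_simps)
  also have "\<dots> = 2 * d * exp (real n * (\<theta>\<^sup>2 / 2 / (1 - \<theta> * L / 3) * ((d + 1) * s\<^sup>2)) - \<theta> * \<delta>)"
    by (simp only: B_def exp_of_nat_mult[symmetric] diff_conv_add_uminus exp_add mult.assoc)
  also have "real n * (\<theta>\<^sup>2 / 2 / (1 - \<theta> * L / 3) * ((d + 1) * s\<^sup>2)) - \<theta> * \<delta>
      = - (real n * \<delta>\<^sup>2 / (2 * d + 2 + 2 * \<delta> * (d + 1) / 3))"
  proof -
    have nL: "real n * ((d + 1) * s\<^sup>2) = L"
      using n by (simp add: L_def s_def power2_eq_square)
    have "1 - \<theta> * L / 3 = 1 / (1 + \<delta> / 3)"
      unfolding \<theta>L using \<delta> by (simp add: divide_simps)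
    then have "real n * (\<theta>\<^sup>2 / 2 / (1 - \<theta> * L / 3) * ((d + 1) * s\<^sup>2)) = \<theta>\<^sup>2 / 2 / (1 / (1 + \<delta> / 3)) * L"
      unfolding nL[symmetric] by (simp only: mult.left_commute)
    also have "\<dots> = \<theta> / 2 * (\<theta> * L * (1 + \<delta> / 3))"
      by (simp add: power2_eq_square)
    \<comment> \<open>For this \<open>\<theta>\<close> the moment term is exactly half of
      \<open>\<theta> * \<delta>\<close>, so the other half remains as the exponent.\<close>
    also have "\<dots> = \<theta> * \<delta> / 2"
      unfolding \<theta>L using \<delta> by (simp add: divide_simps)
    finally have half: "real n * (\<theta>\<^sup>2 / 2 / (1 - \<theta> * L / 3) * ((d + 1) * s\<^sup>2)) = \<theta> * \<delta> / 2" .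
    have "real n * (\<theta>\<^sup>2 / 2 / (1 - \<theta> * L / 3) * ((d + 1) * s\<^sup>2)) - \<theta> * \<delta> = - (\<theta> * \<delta> / 2)"
      unfolding half by simp
    also have "\<theta> * \<delta> / 2 = real n * \<delta>\<^sup>2 / (2 * d + 2 + 2 * \<delta> * (d + 1) / 3)"
    proof -
      have denom: "2 * d + 2 + 2 * \<delta> * (d + 1) / 3 = 2 * (d + 1) * (1 + \<delta> / 3)"
        by (simp add: field_simps)
      have \<theta>_eq: "\<theta> = real n * \<delta> / ((d + 1) * (1 + \<delta> / 3))"
        by (simp add: \<theta>_def L_def s_def)
      show ?thesis
        unfolding denom \<theta>_eq
        by (simp only: power2_eq_square times_divide_eq_left times_divide_eq_right divide_divide_eq_left mult_ac)
    qed
    finally show ?thesis .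
  qed
  finally show "measure M E \<le> 2 * d * exp (- (real n * \<delta>\<^sup>2 / (2 * d + 2 + 2 * \<delta> * (d + 1) / 3)))" .
qed

section \<open>Return to the frame operator\<close>

lemma frame_operator_diff_mat_1:
  fixes x :: "nat \<Rightarrow> real ^ 'd"
  assumes "finite I" "I \<noteq> {}"
  shows "frame_operator I x - mat 1 = mat_of (deviation (1 / real (card I)) I x)"
proof -
  have "(\<Sum>i\<in>I. (1 / real (card I)) *\<^sub>R (mat 1 :: real ^ 'd ^ 'd)) = mat 1"
    using assms by (simp add: sum_constant_scaleR del: sum_constant)
  then show ?thesis
    unfolding mat_of_deviation frame_operator_def sum_subtractf
    by (simp add: vec_eq_iff matrix_matrix_mult_def columnvector_def rowvector_def)
qed

lemma op_norm_eq_norm: "op_norm (mat_of A) = norm A"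
  by (simp add: op_norm_def norm_sqmat.rep_eq)

lemma frobenius_norm_le: "frobenius_norm (mat_of A) \<le> sqrt (real CARD('d)) * norm A" for A :: "'d::finite sqmat"
  using real_sqrt_le_mono[OF tr_mult_adj_le[of A]]
  by (simp add: frobenius_norm_def tr_mult_adj real_sqrt_mult)

theorem theorem2p4:
  fixes M :: "'a measure" and x :: "nat \<Rightarrow> 'a \<Rightarrow> real ^ 'd" and n :: nat and \<epsilon> :: real
  assumes "prob_space M"
    and "n \<ge> 1"
    and "prob_space.indep_vars M (\<lambda>_. borel) x {1..n}"
    and "\<And>i. i \<in> {1..n} \<Longrightarrow>
      distr M borel (x i) =
        uniform_measure lborel (cball 0 (sqrt ((real CARD('d) + 2) / real n)))"
    and "\<epsilon> \<ge> 0"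
  shows "measure M {\<omega> \<in> space M. op_norm (frame_operator {1..n} (\<lambda>i. x i \<omega>) - mat 1) \<ge> \<epsilon>}
      \<le> 2 * real CARD('d) * exp (- (real n * \<epsilon>\<^sup>2 /
            (2 * real CARD('d) + 2 + 2 * \<epsilon> * (real CARD('d) + 1) / 3)))
    \<and> measure M {\<omega> \<in> space M. frobenius_norm (frame_operator {1..n} (\<lambda>i. x i \<omega>) - mat 1) \<ge> \<epsilon>}
      \<le> 2 * real CARD('d) * exp (- (real n * \<epsilon>\<^sup>2 /
            (2 * (real CARD('d))\<^sup>2 + 2 * real CARD('d)
              + 2 * \<epsilon> * sqrt (real CARD('d)) * (real CARD('d) + 1) / 3)))"
proof -
  interpret prob_space M by fact
  let ?Y = "\<lambda>\<omega>. deviation (1 / real n) {1..n} (\<lambda>i. x i \<omega>)"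
  define d where "d = real CARD('d)"
  \<comment> \<open>The Frobenius norm is at most \<open>sqrt d\<close> times the operator norm, so
    a Frobenius deviation \<open>\<epsilon>\<close> forces an operator norm deviation
    \<open>\<delta>\<close>.\<close>
  define \<delta> where "\<delta> = \<epsilon> / sqrt d"
  have d: "0 < d"
    by (simp add: d_def)
  have Y: "frame_operator {1..n} (\<lambda>i. x i \<omega>) - mat 1 = mat_of (?Y \<omega>)" for \<omega>
    using \<open>n \<ge> 1\<close> by (simp add: frame_operator_diff_mat_1)
  have "0 \<le> \<delta>"
    using \<open>\<epsilon> \<ge> 0\<close> d by (simp add: \<delta>_def)
  note tail = tail_norm_deviation[OF assms(1-4) this] 
  have "\<delta> \<le> norm (?Y \<omega>)" if "\<epsilon> \<le> frobenius_norm (mat_of (?Y \<omega>))" for \<omega>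
  proof -
    have "\<epsilon> \<le> sqrt d * norm (?Y \<omega>)"
      using that frobenius_norm_le[of "?Y \<omega>"] by (simp add: d_def)
    then show ?thesis
      using d by (simp add: \<delta>_def field_simps)
  qed
  then have "measure M {\<omega> \<in> space M. frobenius_norm (mat_of (?Y \<omega>)) \<ge> \<epsilon>} \<le> measure M {\<omega> \<in> space M. \<delta> \<le> norm (?Y \<omega>)}"
    by (intro finite_measure_mono[OF _ tail(1)]) auto
  also have "\<dots> \<le> 2 * d * exp (- (real n * \<delta>\<^sup>2 / (2 * d + 2 + 2 * \<delta> * (d + 1) / 3)))"
    unfolding d_def by (rule tail(2))
  also have "real n * \<delta>\<^sup>2 / (2 * d + 2 + 2 * \<delta> * (d + 1) / 3)
      = real n * \<epsilon>\<^sup>2 / (2 * d\<^sup>2 + 2 * d + 2 * \<epsilon> * sqrt d * (d + 1) / 3)"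
  proof -
    \<comment> \<open>Multiplying numerator and denominator by \<open>d\<close> converts the
      exponent at \<open>\<delta>\<close> into the one stated for \<open>\<epsilon>\<close>.\<close>
    have "\<delta>\<^sup>2 = \<epsilon>\<^sup>2 / d" and "\<delta> * d = \<epsilon> * sqrt d"
      using d by (simp_all add: \<delta>_def power_divide) (simp add: real_div_sqrt divide_simps)
    moreover have "2 * \<epsilon> * sqrt d * (d + 1) / 3 = 2 * (\<delta> * d) * (d + 1) / 3"
      unfolding \<open>\<delta> * d = \<epsilon> * sqrt d\<close> by simp
    then have "2 * d\<^sup>2 + 2 * d + 2 * \<epsilon> * sqrt d * (d + 1) / 3 = d * (2 * d + 2 + 2 * \<delta> * (d + 1) / 3)"
      by (simp add: algebra_simps power2_eq_square)
    ultimately show ?thesis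
      by simp
  qed
  finally show ?thesis
    unfolding Y op_norm_eq_norm using tail_norm_deviation(2)[OF assms] by (simp add: d_def)
qed

end
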